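(* At the $k$th iteration of {\sf m-d-Lawson} with $\boldsymbol w^{(k)}\in\mathcal S$, assume $d(\boldsymbol w^{(k)})$ is a simple eigenvalue of the matrix pencil $(A_{\boldsymbol w^{(k)}},B_{\boldsymbol w^{(k)}})$. Assume conditions (A1) and (A2) of the context. Suppose $\tau_\ell^{(k)}:=\|F(x_\ell)-R^{(k)}(x_\ell)\|_{\mathrm F}>0$ for all $\ell\in\mathcal J_{\boldsymbol w^{(k)}}:=\{j: w_j^{(k)}\ne0,\ 1\le j\le m\}$. Let $\boldsymbol w^{(k+1)}$ be the update of $\boldsymbol w^{(k)}$ with Lawson exponent $\beta$. Then: (i) there exists $\beta_0>0$ such that for all $\beta\in(0,\beta_0)$, $d(\boldsymbol w^{(k+1)})\ge d(\boldsymbol w^{(k)})$; (ii) for any sufficiently small $\beta>0$, $$d(\boldsymbol w^{(k+1)})=d(\boldsymbol w^{(k)})\ \Longrightarrow\ w_\ell^{(k)}\tau_\ell^{(k)}\big(\tau_\ell^{(k)}-c\big)=0,\quad\forall\,1\le\ell\le m,$$ where $c=\sqrt{d(\boldsymbol w^{(k)})}\le\sqrt{e(R^{(k)})}=\max_{1\le\ell\le m}\tau_\ell^{(k)}$; (iii) in the situation of (ii) (i.e. $d(\boldsymbol w^{(k+1)})=d(\boldsymbol w^{(k)})$ for a sufficiently small $\beta>0$), if additionally $c\ge\max_{\ell\notin\mathcal J_{\boldsymbol w^{(k)}}}\tau_\ell^{(k)}$, then $R^{(k)}$ is a minimax approximant, i.e. a solution of $\inf_{R\in\mathscr R_{(s,t)}}\max_{1\le\ell\le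 m}\|F(x_\ell)-R(x_\ell)\|_{\mathrm F}^2$.
   Context: $s,t\ge1$ and $d,n_{ij}\ge0$ are given integers; $\mathbb P_n$ is the set of complex polynomials of degree at most $n$; $\mathcal X=\{x_\ell\}_{\ell=1}^m\subset\mathbb C$ are distinct nodes with $m\ge\max_{i,j}\{n_{ij}+d+2\}$; $F(x_\ell)=[f_{ij}(x_\ell)]\in\mathbb C^{s\times t}$ are given data; $\|\cdot\|_{\mathrm F}$ is the Frobenius norm. $\mathscr R_{(s,t)}$ is the set of $R=[r_{ij}]$ of size $s\times t$ with $r_{ij}=p_{ij}/q$, $p_{ij}\in\mathbb P_{n_{ij}}$, common denominator $0\not\equiv q\in\mathbb P_d$ (values at nodes where $q$ vanishes are understood after cancelling common zeros; a remaining pole gives error $+\infty$). $e(R)=\max_{1\le\ell\le m}\|F(x_\ell)-R(x_\ell)\|_{\mathrm F}^2$. $\mathcal S=\{\boldsymbol w\in\mathbb R^m:\boldsymbol w\ge0,\sum_\ell w_\ell=1\}$, and $$d(\boldsymbol w)=\min\Big\{\sum_{\ell=1}^m w_\ell\sum_{i,j}|f_{ij}(x_\ell)q(x_\ell)-p_{ij}(x_\ell)|^2:\ p_{ij}\in\mathbb P_{n_{ij}},\ q\in\mathbb P_d,\ \sum_{\ell=1}^m w_\ell|q(x_\ell)|^2=1\Big\}.$$ Pencil: $g=st$, $n=\sum_{i,j}(n_{ij}+1)$. For fixed bases $\{\psi_0,\dots,\psi_{n_{ij}}\}$ of $\mathbb P_{n_{ij}}$ and $\{\phi_0,\dots,\phi_d\}$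 of $\mathbb P_d$ (e.g. monomials), $\mathbf\Psi_{ij}=[\psi_{k-1}(x_\ell)]_{\ell,k}\in\mathbb C^{m\times(n_{ij}+1)}$, $\mathbf\Phi=[\phi_{k-1}(x_\ell)]_{\ell,k}\in\mathbb C^{m\times(d+1)}$, $F_{ij}=\mathrm{diag}(f_{ij}(x_1),\dots,f_{ij}(x_m))$; with pairs ordered $(1,1),\dots,(s,1),(1,2),\dots,(s,t)$, $\boldsymbol F\in\mathbb C^{gm\times m}$ is the vertical stack of the $F_{ij}$ and $\mathbf\Theta\in\mathbb C^{gm\times n}$ is block diagonal with blocks $\mathbf\Psi_{ij}$. With $W=\mathrm{diag}(\boldsymbol w)$, $\boldsymbol W_\otimes=I_g\otimes W$, $$A_{\boldsymbol w}=[-\mathbf\Theta,\boldsymbol F\mathbf\Phi]^{\mathrm H}\boldsymbol W_\otimes[-\mathbf\Theta,\boldsymbol F\mathbf\Phi],\qquad B_{\boldsymbol w}=[0_{m\times n},\mathbf\Phi]^{\mathrm H}W[0_{m\times n},\mathbf\Phi].$$ $d(\boldsymbol w)$ is the smallest (finite) eigenvalue of the problem $A_{\boldsymbol w}\boldsymbol c=\lambda B_{\boldsymbol w}\boldsymbol c$, $\boldsymbol c^{\mathrm H}B_{\boldsymbol w}\boldsymbol c=1$. Iteration {\sf m-d-Lawson} with Lawson exponent $\beta>0$: start from $\boldsymbol w^{(0)}\in\mathcal S$ with positive entries. At step $k$, let $(\{p^{(k)}_{ij}\},q^{(k)})$ attain the minimum $d(\boldsymbol w^{(k)})$, set $R^{(k)}=[p^{(k)}_{ij}/q^{(k)}]$,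 and update $$w_\ell^{(k+1)}=\frac{w_\ell^{(k)}\|F(x_\ell)-R^{(k)}(x_\ell)\|_{\mathrm F}^\beta}{\sum_{i=1}^m w_i^{(k)}\|F(x_i)-R^{(k)}(x_i)\|_{\mathrm F}^\beta},\quad 1\le\ell\le m.$$ Assumptions: (A1) $q^{(k)}(x_\ell)\ne0$ for all $1\le\ell\le m$ and all $k\ge0$. (A2) For all $k\ge0$, the set $\mathcal J_{\boldsymbol w^{(k)}}=\{\ell:w_\ell^{(k)}\ne0\}$ has cardinality at least $\max\{d+1,\max_{i,j}(n_{ij}+1)\}$. *)

theory Defs
  imports
    "HOL-Library.Extended_Real"
    "HOL-Computational_Algebra.Field_as_Ring"
    "HOL-Computational_Algebra.Polynomial_Factorial"
    "Jordan_Normal_Form.Schur_Decomposition"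
begin

text \<open>
  All indices are 0-based: \<open>i < s\<close>, \<open>j < t\<close>, \<open>l < m\<close>. The data are given by functions \<open>f i j\<close>
  of which only the values at the nodes \<open>x l\<close>, \<open>l < m\<close>, are ever used; likewise a weight vector
  is a function \<open>w\<close> of which only \<open>w l\<close>, \<open>l < m\<close>, matters.
\<close>

subsection \<open>Rational matrices and their errors\<close>

definition poly_space :: "nat \<Rightarrow> complex poly set" where
  "poly_space N = {p. degree p \<le> N}"

definition poly_basis :: "nat \<Rightarrow> (nat \<Rightarrow> complex poly) \<Rightarrow> bool" where
  "poly_basis N b \<longleftrightarrow>
     (\<forall>k\<le>N. b k \<in> poly_space N) \<and>
     (\<forall>p\<in>poly_space N. \<exists>c. p = (\<Sum>k\<le>N. smult (c k) (b k))) \<and>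
     (\<forall>c. (\<Sum>k\<le>N. smult (c k) (b k)) = 0 \<longrightarrow> (\<forall>k\<le>N. c k = 0))"

definition frob_norm :: "complex mat \<Rightarrow> real" where
  "frob_norm M = sqrt (\<Sum>i<dim_row M. \<Sum>j<dim_col M. (cmod (M $$ (i,j)))\<^sup>2)"

definition data_mat :: "nat \<Rightarrow> nat \<Rightarrow> (nat \<Rightarrow> nat \<Rightarrow> complex \<Rightarrow> complex) \<Rightarrow> complex \<Rightarrow> complex mat" where
  "data_mat s t f z = mat s t (\<lambda>(i,j). f i j z)"

definition ratmat ::
  "nat \<Rightarrow> nat \<Rightarrow> (nat \<Rightarrow> nat \<Rightarrow> complex poly) \<Rightarrow> complex poly \<Rightarrow> complex poly fract mat" where
  "ratmat s t p q = mat s t (\<lambda>(i,j). Fract (p i j) q)"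

definition ratmats :: "nat \<Rightarrow> nat \<Rightarrow> (nat \<Rightarrow> nat \<Rightarrow> nat) \<Rightarrow> nat \<Rightarrow> complex poly fract mat set" where
  "ratmats s t n d =
     {ratmat s t p q | p q.
        (\<forall>i<s. \<forall>j<t. p i j \<in> poly_space (n i j)) \<and> q \<in> poly_space d \<and> q \<noteq> 0}"

text \<open>
  \<open>quot_of_fract\<close> returns the coprime representation of a fraction, so evaluating it is
  evaluation after cancellation of common zeros. At a pole \<open>rat_eval\<close> has a junk value;
  \<open>sq_error\<close> below assigns the error \<open>\<infinity>\<close> in that case.
\<close>

definition has_pole :: "complex poly fract \<Rightarrow> complex \<Rightarrow> bool" where
  "has_pole r z \<longleftrightarrow> poly (snd (quot_of_fract r)) z = 0"

definition rat_eval :: "complex poly fract \<Rightarrow> complex \<Rightarrow> complex" where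
  "rat_eval r z = poly (fst (quot_of_fract r)) z / poly (snd (quot_of_fract r)) z"

definition residual ::
  "nat \<Rightarrow> nat \<Rightarrow> (nat \<Rightarrow> nat \<Rightarrow> complex \<Rightarrow> complex) \<Rightarrow> complex poly fract mat \<Rightarrow> complex \<Rightarrow> real" where
  "residual s t f R z = frob_norm (data_mat s t f z - map_mat (\<lambda>r. rat_eval r z) R)"

definition sq_error ::
  "nat \<Rightarrow> nat \<Rightarrow> (nat \<Rightarrow> nat \<Rightarrow> complex \<Rightarrow> complex) \<Rightarrow> complex poly fract mat \<Rightarrow> complex \<Rightarrow> ereal" where
  "sq_error s t f R z =
     (if \<exists>i<s. \<exists>j<t. has_pole (R $$ (i,j)) z then \<infinity> else ereal ((residual s t f R z)\<^sup>2))"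

definition max_sq_error ::
  "nat \<Rightarrow> nat \<Rightarrow> nat \<Rightarrow> (nat \<Rightarrow> complex) \<Rightarrow> (nat \<Rightarrow> nat \<Rightarrow> complex \<Rightarrow> complex)
     \<Rightarrow> complex poly fract mat \<Rightarrow> ereal" where
  "max_sq_error s t m x f R = (MAX l\<in>{..<m}. sq_error s t f R (x l))"

definition is_minimax_approximant ::
  "nat \<Rightarrow> nat \<Rightarrow> (nat \<Rightarrow> nat \<Rightarrow> nat) \<Rightarrow> nat \<Rightarrow> nat \<Rightarrow> (nat \<Rightarrow> complex)
     \<Rightarrow> (nat \<Rightarrow> nat \<Rightarrow> complex \<Rightarrow> complex) \<Rightarrow> complex poly fract mat \<Rightarrow> bool" where
  "is_minimax_approximant s t n d m x f R \<longleftrightarrow>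
     R \<in> ratmats s t n d \<and>
     max_sq_error s t m x f R = (INF R'\<in>ratmats s t n d. max_sq_error s t m x f R')"

subsection \<open>The dual function\<close>

definition weight_simplex :: "nat \<Rightarrow> (nat \<Rightarrow> real) set" where
  "weight_simplex m = {w. (\<forall>l<m. 0 \<le> w l) \<and> (\<Sum>l<m. w l) = 1}"

definition weight_support :: "nat \<Rightarrow> (nat \<Rightarrow> real) \<Rightarrow> nat set" where
  "weight_support m w = {l. l < m \<and> w l \<noteq> 0}"

definition dual_objective ::
  "nat \<Rightarrow> nat \<Rightarrow> nat \<Rightarrow> (nat \<Rightarrow> complex) \<Rightarrow> (nat \<Rightarrow> nat \<Rightarrow> complex \<Rightarrow> complex)
     \<Rightarrow> (nat \<Rightarrow> real) \<Rightarrow> (nat \<Rightarrow> nat \<Rightarrow> complex poly) \<Rightarrow> complex poly \<Rightarrow> real" where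
  "dual_objective s t m x f w p q =
     (\<Sum>l<m. w l * (\<Sum>i<s. \<Sum>j<t. (cmod (f i j (x l) * poly q (x l) - poly (p i j) (x l)))\<^sup>2))"

definition dual_feasible ::
  "nat \<Rightarrow> nat \<Rightarrow> (nat \<Rightarrow> nat \<Rightarrow> nat) \<Rightarrow> nat \<Rightarrow> nat \<Rightarrow> (nat \<Rightarrow> complex)
     \<Rightarrow> (nat \<Rightarrow> real) \<Rightarrow> (nat \<Rightarrow> nat \<Rightarrow> complex poly) \<Rightarrow> complex poly \<Rightarrow> bool" where
  "dual_feasible s t n d m x w p q \<longleftrightarrow>
     (\<forall>i<s. \<forall>j<t. p i j \<in> poly_space (n i j)) \<and> q \<in> poly_space d \<and>
     (\<Sum>l<m. w l * (cmod (poly q (x l)))\<^sup>2) = 1"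

text \<open>
  For weights in the simplex the infimum is attained (only the values on the support of \<open>w\<close>
  matter), so it is the minimum; attainment by a given pair is \<open>dual_minimizer\<close>.
\<close>

definition dual_value ::
  "nat \<Rightarrow> nat \<Rightarrow> (nat \<Rightarrow> nat \<Rightarrow> nat) \<Rightarrow> nat \<Rightarrow> nat \<Rightarrow> (nat \<Rightarrow> complex)
     \<Rightarrow> (nat \<Rightarrow> nat \<Rightarrow> complex \<Rightarrow> complex) \<Rightarrow> (nat \<Rightarrow> real) \<Rightarrow> real" where
  "dual_value s t n d m x f w =
     Inf {dual_objective s t m x f w p q | p q. dual_feasible s t n d m x w p q}"

definition dual_minimizer ::
  "nat \<Rightarrow> nat \<Rightarrow> (nat \<Rightarrow> nat \<Rightarrow> nat) \<Rightarrow> nat \<Rightarrow> nat \<Rightarrow> (nat \<Rightarrow> complex)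
     \<Rightarrow> (nat \<Rightarrow> nat \<Rightarrow> complex \<Rightarrow> complex) \<Rightarrow> (nat \<Rightarrow> real)
     \<Rightarrow> (nat \<Rightarrow> nat \<Rightarrow> complex poly) \<Rightarrow> complex poly \<Rightarrow> bool" where
  "dual_minimizer s t n d m x f w p q \<longleftrightarrow>
     dual_feasible s t n d m x w p q \<and>
     dual_objective s t m x f w p q = dual_value s t n d m x f w"

subsection \<open>The matrix pencil\<close>

definition hcat :: "'a::zero mat \<Rightarrow> 'a mat \<Rightarrow> 'a mat" where
  "hcat A B = four_block_mat A B (0\<^sub>m 0 (dim_col A)) (0\<^sub>m 0 (dim_col B))"

definition basis_mat :: "nat \<Rightarrow> (nat \<Rightarrow> complex) \<Rightarrow> nat \<Rightarrow> (nat \<Rightarrow> complex poly) \<Rightarrow> complex mat" where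
  "basis_mat m x N b = mat m (N + 1) (\<lambda>(l,k). poly (b k) (x l))"

text \<open>Column-major order: \<open>(0,0), \<dots>, (s-1,0), (0,1), \<dots>, (s-1,t-1)\<close>.\<close>

definition index_pairs :: "nat \<Rightarrow> nat \<Rightarrow> (nat \<times> nat) list" where
  "index_pairs s t = [(i,j). j \<leftarrow> [0..<t], i \<leftarrow> [0..<s]]"

definition data_stack ::
  "nat \<Rightarrow> nat \<Rightarrow> nat \<Rightarrow> (nat \<Rightarrow> complex) \<Rightarrow> (nat \<Rightarrow> nat \<Rightarrow> complex \<Rightarrow> complex) \<Rightarrow> complex mat" where
  "data_stack s t m x f =
     foldr (@\<^sub>r) (map (\<lambda>(i,j). mat_diag m (\<lambda>l. f i j (x l))) (index_pairs s t)) (0\<^sub>m 0 m)"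

definition Theta_mat ::
  "nat \<Rightarrow> nat \<Rightarrow> (nat \<Rightarrow> nat \<Rightarrow> nat) \<Rightarrow> nat \<Rightarrow> (nat \<Rightarrow> complex)
     \<Rightarrow> (nat \<Rightarrow> nat \<Rightarrow> nat \<Rightarrow> complex poly) \<Rightarrow> complex mat" where
  "Theta_mat s t n m x psi =
     diag_block_mat (map (\<lambda>(i,j). basis_mat m x (n i j) (psi i j)) (index_pairs s t))"

definition weight_mat :: "nat \<Rightarrow> (nat \<Rightarrow> real) \<Rightarrow> complex mat" where
  "weight_mat m w = mat_diag m (\<lambda>l. complex_of_real (w l))"

definition pencil_A ::
  "nat \<Rightarrow> nat \<Rightarrow> (nat \<Rightarrow> nat \<Rightarrow> nat) \<Rightarrow> nat \<Rightarrow> nat \<Rightarrow> (nat \<Rightarrow> complex)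
     \<Rightarrow> (nat \<Rightarrow> nat \<Rightarrow> complex \<Rightarrow> complex)
     \<Rightarrow> (nat \<Rightarrow> nat \<Rightarrow> nat \<Rightarrow> complex poly) \<Rightarrow> (nat \<Rightarrow> complex poly)
     \<Rightarrow> (nat \<Rightarrow> real) \<Rightarrow> complex mat" where
  "pencil_A s t n d m x f psi phi w =
     (let M = hcat (- Theta_mat s t n m x psi) (data_stack s t m x f * basis_mat m x d phi)
      in mat_adjoint M * diag_block_mat (replicate (s * t) (weight_mat m w)) * M)"

definition pencil_B ::
  "nat \<Rightarrow> nat \<Rightarrow> (nat \<Rightarrow> nat \<Rightarrow> nat) \<Rightarrow> nat \<Rightarrow> nat \<Rightarrow> (nat \<Rightarrow> complex)
     \<Rightarrow> (nat \<Rightarrow> complex poly) \<Rightarrow> (nat \<Rightarrow> real) \<Rightarrow> complex mat" where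
  "pencil_B s t n d m x phi w =
     (let M = hcat (0\<^sub>m m (\<Sum>i<s. \<Sum>j<t. n i j + 1)) (basis_mat m x d phi)
      in mat_adjoint M * weight_mat m w * M)"

definition pencil_char_poly :: "complex mat \<Rightarrow> complex mat \<Rightarrow> complex poly" where
  "pencil_char_poly A B =
     det (map_mat (\<lambda>a. [:a:]) A - [:0, 1:] \<cdot>\<^sub>m map_mat (\<lambda>b. [:b:]) B)"

text \<open>
  A simple eigenvalue of a pencil is a simple root of \<open>det (A - \<lambda> B)\<close>; the pencil is required to
  be regular, since \<open>order\<close> is meaningless on the zero polynomial.
\<close>

definition simple_pencil_eigenvalue :: "complex mat \<Rightarrow> complex mat \<Rightarrow> complex \<Rightarrow> bool" where
  "simple_pencil_eigenvalue A B lam \<longleftrightarrow>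
     pencil_char_poly A B \<noteq> 0 \<and> order lam (pencil_char_poly A B) = 1"

subsection \<open>The iteration\<close>

definition lawson_update :: "nat \<Rightarrow> (nat \<Rightarrow> real) \<Rightarrow> real \<Rightarrow> (nat \<Rightarrow> real) \<Rightarrow> nat \<Rightarrow> real" where
  "lawson_update m tau beta w l =
     w l * tau l powr beta / (\<Sum>i<m. w i * tau i powr beta)"

text \<open>
  A run of the iteration. The exponent used at step \<open>k\<close> is \<open>b k > 0\<close>; a constant \<open>b\<close> is the
  iteration with one fixed Lawson exponent.
\<close>

definition md_Lawson_run ::
  "nat \<Rightarrow> nat \<Rightarrow> (nat \<Rightarrow> nat \<Rightarrow> nat) \<Rightarrow> nat \<Rightarrow> nat \<Rightarrow> (nat \<Rightarrow> complex)
     \<Rightarrow> (nat \<Rightarrow> nat \<Rightarrow> complex \<Rightarrow> complex) \<Rightarrow> (nat \<Rightarrow> real) \<Rightarrow> (nat \<Rightarrow> nat \<Rightarrow> real)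
     \<Rightarrow> (nat \<Rightarrow> nat \<Rightarrow> nat \<Rightarrow> complex poly) \<Rightarrow> (nat \<Rightarrow> complex poly) \<Rightarrow> bool" where
  "md_Lawson_run s t n d m x f b w p q \<longleftrightarrow>
     w 0 \<in> weight_simplex m \<and> (\<forall>l<m. 0 < w 0 l) \<and>
     (\<forall>k. 0 < b k) \<and>
     (\<forall>k. dual_minimizer s t n d m x f (w k) (p k) (q k)) \<and>
     (\<forall>k. \<forall>l<m. w (Suc k) l =
        lawson_update m (\<lambda>i. residual s t f (ratmat s t (p k) (q k)) (x i)) (b k) (w k) l)"

end

theory Submission
  imports Defs "HOL-Computational_Algebra.Fundamental_Theorem_Algebra"
begin

text \<open>
  Write \<open>N\<close> and \<open>Q\<close> for the squared linearized residual and the squared modulus of the denominator at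
  a node, and \<open>\<lambda> = c\<^sup>2\<close> for the dual value at \<open>w\<close>. Every pair \<open>(p, q)\<close> satisfies
  \<open>\<Sum> w (N - \<lambda> Q) \<ge> 0\<close>, with equality at the minimizers, which are therefore eigenvectors of the pencil for
  \<open>\<lambda>\<close>; simplicity of \<open>\<lambda>\<close> makes the minimizer unique up to a scalar. At the minimizer
  \<open>N = \<tau>\<^sup>2 Q\<close>, so the formal derivative of the dual value along the update at \<open>\<beta> = 0\<close> is
  \<open>\<Sum> w ln \<tau> (\<tau>\<^sup>2 - c\<^sup>2) Q = \<Sum> w (ln \<tau> - ln c) (\<tau>\<^sup>2 - c\<^sup>2) Q\<close>, a sum of nonnegative terms that
  vanishes only if \<open>\<tau> = c\<close> on the support of \<open>w\<close>.

  No perturbation theory of eigenvalues is needed: if the dual value failed to increase for some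
  \<open>\<beta>\<^sub>k \<rightarrow> 0\<close>, then near-minimizers for the updated weights would subconverge to a minimizer for \<open>w\<close>,
  hence to a multiple of the given one, and dividing the optimality inequalities by \<open>\<beta>\<^sub>k\<close> would show
  that the derivative above is at most \<open>0\<close>. If instead \<open>\<tau> = c\<close> on the support, the update
  does not change \<open>w\<close>, and optimality follows from weak duality.
\<close>

subsection \<open>Compactness of bounded families of polynomials\<close>

lemma Bseq_complex_convergent_subseq:
  fixes y :: "nat \<Rightarrow> complex"
  assumes "Bseq y"
  obtains r z where "strict_mono (r :: nat \<Rightarrow> nat)" "(\<lambda>k. y (r k)) \<longlonglongrightarrow> z"
proof -
  from assms obtain K where "\<forall>k. cmod (y k) \<le> K" unfolding Bseq_def by blast
  from Bolzano_Weierstrass_complex_disc[OF this] obtain r z where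
    "strict_mono (r :: nat \<Rightarrow> nat)" and r: "\<forall>e>0. \<exists>N. \<forall>k\<ge>N. cmod (y (r k) - z) < e" by blast
  then have "(\<lambda>k. y (r k)) \<longlonglongrightarrow> z" by (intro LIMSEQ_I) auto
  with \<open>strict_mono r\<close> show ?thesis by (rule that)
qed

text \<open>Induction on the degree bound: splitting off \<open>z - a\<close> at one of the points
  leaves quotients of smaller degree that stay bounded at the remaining points, because there they
  are difference quotients with a fixed nonzero denominator. Convergence is stated as pointwise
  convergence of values, which is the only form in which the objective and the constraint see a
  polynomial.\<close>

lemma poly_space_convergent_subseq:
  fixes P :: "nat \<Rightarrow> complex poly"
  assumes "\<And>k. P k \<in> poly_space N" "finite S" "N < card S" "\<And>a. a \<in> S \<Longrightarrow> Bseq (\<lambda>k. poly (P k) a)"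
  shows "\<exists>r L. strict_mono (r :: nat \<Rightarrow> nat) \<and> L \<in> poly_space N \<and>
           (\<forall>z. (\<lambda>k. poly (P (r k)) z) \<longlonglongrightarrow> poly L z)"
  using assms
proof (induction N arbitrary: P S)
  case 0
  then obtain a where a: "a \<in> S" by fastforce
  obtain r z where r: "strict_mono r" "(\<lambda>k. poly (P (r k)) a) \<longlonglongrightarrow> z"
    using Bseq_complex_convergent_subseq[OF 0(4)[OF a]] by blast
  have const: "poly (P k) y = poly (P k) a" for k y
    using 0(1)[of k] by (auto simp: poly_space_def elim!: degree_eq_zeroE)
  have "(\<lambda>k. poly (P (r k)) y) \<longlonglongrightarrow> poly [:z:] y" for y
    using r(2) const[of _ y] by simp
  moreover have "[:z:] \<in> poly_space 0" by (simp add: poly_space_def)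
  ultimately show ?case using r(1) by blast
next
  case (Suc N)
  from Suc.prems obtain a where a: "a \<in> S" by fastforce
  define Q where "Q k = synthetic_div (P k) a" for k
  have P: "P k = [:-a, 1:] * Q k + [:poly (P k) a:]" for k
    using synthetic_div_correct'[of a "P k"] by (simp add: Q_def)
  have Pz: "poly (P k) z = (z - a) * poly (Q k) z + poly (P k) a" for k z
    by (subst P) (simp add: algebra_simps)
  have Q: "Q k \<in> poly_space N" for k
    using Suc.prems(1)[of k] by (simp add: Q_def poly_space_def degree_synthetic_div)
  have bnd: "Bseq (\<lambda>k. poly (Q k) z)" if z: "z \<in> S - {a}" for z
  proof -
    from z have "Bseq (\<lambda>k. poly (P k) z)" by (intro Suc.prems(4)) auto
    then obtain K1 where K1: "\<And>k. cmod (poly (P k) z) \<le> K1" unfolding Bseq_def by blast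
    obtain K2 where K2: "\<And>k. cmod (poly (P k) a) \<le> K2"
      using Suc.prems(4)[OF a] unfolding Bseq_def by blast
    have "cmod (poly (Q k) z) \<le> (K1 + K2) / cmod (z - a)" for k
    proof -
      have "poly (Q k) z = (poly (P k) z - poly (P k) a) / (z - a)"
        using Pz[of k z] z by (simp add: field_simps)
      then show ?thesis
        using K1[of k] K2[of k] norm_triangle_ineq4[of "poly (P k) z" "poly (P k) a"]
        by (auto simp: norm_divide intro!: divide_right_mono)
    qed
    then show ?thesis by (rule BseqI')
  qed
  have "finite (S - {a})" "N < card (S - {a})" using Suc.prems(2,3) a by auto
  from Suc.IH[OF Q this bnd] obtain r1 L where r1: "strict_mono r1" "L \<in> poly_space N"
    "\<And>z. (\<lambda>k. poly (Q (r1 k)) z) \<longlonglongrightarrow> poly L z" by blast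
  have "Bseq (\<lambda>k. poly (P (r1 k)) a)" using Suc.prems(4)[OF a] by (rule Bseq_subseq)
  then obtain r2 y where r2: "strict_mono r2" "(\<lambda>k. poly (P (r1 (r2 k))) a) \<longlonglongrightarrow> y"
    by (rule Bseq_complex_convergent_subseq)
  have "(\<lambda>k. poly (P (r1 (r2 k))) z) \<longlonglongrightarrow> poly ([:-a,1:] * L + [:y:]) z" for z
  proof -
    have "(\<lambda>k. poly (Q (r1 (r2 k))) z) \<longlonglongrightarrow> poly L z"
      using LIMSEQ_subseq_LIMSEQ[OF r1(3) r2(1)] by (simp add: o_def)
    then have "(\<lambda>k. (z - a) * poly (Q (r1 (r2 k))) z + poly (P (r1 (r2 k))) a)
        \<longlonglongrightarrow> (z - a) * poly L z + y"
      by (intro tendsto_intros r2(2))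
    then show ?thesis unfolding Pz[symmetric] by (simp add: algebra_simps)
  qed
  moreover have "[:-a,1:] * L + [:y:] \<in> poly_space (Suc N)"
  proof -
    have "degree ([:-a,1:] * L) \<le> Suc N"
      using r1(2) degree_mult_le[of "[:-a,1:]" L] by (simp add: poly_space_def)
    then show ?thesis by (auto simp: poly_space_def intro!: degree_add_le)
  qed
  moreover have "strict_mono (\<lambda>k. r1 (r2 k))"
    using strict_mono_o[OF r1(1) r2(1)] by (simp add: o_def)
  ultimately show ?case by blast
qed

text \<open>Subsequences are extracted one index after the other; limits already obtained survive
  further thinning. All members share the sample set \<open>S\<close>, but each has its own degree
  bound.\<close>

lemma poly_family_convergent_subseq:
  fixes P :: "'i \<Rightarrow> nat \<Rightarrow> complex poly"
  assumes "finite I" "finite S"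
    "\<And>i k. i \<in> I \<Longrightarrow> P i k \<in> poly_space (N i)" "\<And>i. i \<in> I \<Longrightarrow> N i < card S"
    "\<And>i a. i \<in> I \<Longrightarrow> a \<in> S \<Longrightarrow> Bseq (\<lambda>k. poly (P i k) a)"
  shows "\<exists>r L. strict_mono (r :: nat \<Rightarrow> nat) \<and>
           (\<forall>i\<in>I. L i \<in> poly_space (N i) \<and> (\<forall>z. (\<lambda>k. poly (P i (r k)) z) \<longlonglongrightarrow> poly (L i) z))"
  using assms(1,3-5)
proof (induction I)
  case empty
  then show ?case by (auto intro!: exI[of _ id] simp: strict_mono_id)
next
  case (insert i I)
  have "\<exists>r L. strict_mono (r :: nat \<Rightarrow> nat) \<and> (\<forall>i\<in>I. L i \<in> poly_space (N i) \<and>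
      (\<forall>z. (\<lambda>k. poly (P i (r k)) z) \<longlonglongrightarrow> poly (L i) z))"
    by (intro insert.IH insert.prems insertI2)
  then obtain r1 L where r1: "strict_mono r1"
    "\<forall>i\<in>I. L i \<in> poly_space (N i) \<and> (\<forall>z. (\<lambda>k. poly (P i (r1 k)) z) \<longlonglongrightarrow> poly (L i) z)"
    by blast
  have "\<exists>r M. strict_mono (r :: nat \<Rightarrow> nat) \<and> M \<in> poly_space (N i) \<and>
           (\<forall>z. (\<lambda>k. poly (P i (r1 (r k))) z) \<longlonglongrightarrow> poly M z)"
  proof (rule poly_space_convergent_subseq[where S = S])
    show "Bseq (\<lambda>k. poly (P i (r1 k)) a)" if "a \<in> S" for a
      using insert.prems(3)[OF insertI1 that] by (rule Bseq_subseq)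
  qed (use insert.prems assms(2) in auto)
  then obtain r2 M where r2: "strict_mono r2" "M \<in> poly_space (N i)"
    "\<And>z. (\<lambda>k. poly (P i (r1 (r2 k))) z) \<longlonglongrightarrow> poly M z" by blast
  have "(\<lambda>k. poly (P j (r1 (r2 k))) z) \<longlonglongrightarrow> poly (L j) z" if "j \<in> I" for j z
    using LIMSEQ_subseq_LIMSEQ[OF _ r2(1), of "\<lambda>k. poly (P j (r1 k)) z"] r1(2) that by (simp add: o_def)
  moreover have "strict_mono (\<lambda>k. r1 (r2 k))"
    using strict_mono_o[OF r1(1) r2(1)] by (simp add: o_def)
  ultimately show ?case using r1(2) r2(2,3) insert.hyps(2)
    by (intro exI[of _ "\<lambda>k. r1 (r2 k)"] exI[of _ "L(i := M)"]) auto
qed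

subsection \<open>Stationarity of dual minimizers\<close>

text \<open>The Hermitian form of A_w - lam B_w written in terms of polynomials, conjugate-linear in
  the primed pair. Optimality can thus be studied before any basis is chosen; coefficient vectors
  enter only when the pencil does.\<close>

definition dual_form ::
  "nat \<Rightarrow> nat \<Rightarrow> nat \<Rightarrow> (nat \<Rightarrow> complex) \<Rightarrow> (nat \<Rightarrow> nat \<Rightarrow> complex \<Rightarrow> complex) \<Rightarrow> (nat \<Rightarrow> real) \<Rightarrow> real
     \<Rightarrow> (nat \<Rightarrow> nat \<Rightarrow> complex poly) \<Rightarrow> complex poly \<Rightarrow> (nat \<Rightarrow> nat \<Rightarrow> complex poly) \<Rightarrow> complex poly \<Rightarrow> complex" where
  "dual_form s t m x f w lam p' q' p q =
     (\<Sum>l<m. complex_of_real (w l) *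
        ((\<Sum>i<s. \<Sum>j<t. cnj (f i j (x l) * poly q' (x l) - poly (p' i j) (x l)) *
            (f i j (x l) * poly q (x l) - poly (p i j) (x l)))
         - complex_of_real lam * (cnj (poly q' (x l)) * poly q (x l))))"

text \<open>The quadratic form belonging to \<open>dual_form\<close>. With \<open>lam\<close> equal
  to the dual value it encodes minimality without the normalization constraint.\<close>

definition weighted_gap ::
  "nat \<Rightarrow> nat \<Rightarrow> nat \<Rightarrow> (nat \<Rightarrow> complex) \<Rightarrow> (nat \<Rightarrow> nat \<Rightarrow> complex \<Rightarrow> complex) \<Rightarrow> (nat \<Rightarrow> real) \<Rightarrow> real
     \<Rightarrow> (nat \<Rightarrow> nat \<Rightarrow> complex poly) \<Rightarrow> complex poly \<Rightarrow> real" where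
  "weighted_gap s t m x f w lam p q =
     dual_objective s t m x f w p q - lam * (\<Sum>l<m. w l * (cmod (poly q (x l)))\<^sup>2)"

lemma dual_form_self:
  "dual_form s t m x f w lam p q p q = complex_of_real (weighted_gap s t m x f w lam p q)"
proof -
  have sq: "cnj z * z = complex_of_real ((cmod z)\<^sup>2)" for z
    by (simp only: complex_norm_square mult.commute)
  show ?thesis
    unfolding dual_form_def weighted_gap_def dual_objective_def sq
    by (simp add: sum_distrib_left sum_subtractf algebra_simps)
qed

lemma dual_form_cnj:
  "dual_form s t m x f w lam p q p' q' = cnj (dual_form s t m x f w lam p' q' p q)"
  unfolding dual_form_def by (simp add: mult.commute)

lemma dual_form_add_smult:
  "dual_form s t m x f w lam p' q' (\<lambda>i j. p1 i j + smult z (p2 i j)) (q1 + smult z q2) =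
     dual_form s t m x f w lam p' q' p1 q1 + z * dual_form s t m x f w lam p' q' p2 q2"
proof -
  have *: "a * ((\<Sum>i<s. \<Sum>j<t. b i j * (c i j * (y1 + z * y2) - (d1 i j + z * d2 i j))) - e * (g * (y1 + z * y2)))
    = a * ((\<Sum>i<s. \<Sum>j<t. b i j * (c i j * y1 - d1 i j)) - e * (g * y1))
      + z * (a * ((\<Sum>i<s. \<Sum>j<t. b i j * (c i j * y2 - d2 i j)) - e * (g * y2)))"
    for a b c d1 d2 e g y1 and y2 :: complex
  proof -
    have "(\<Sum>i<s. \<Sum>j<t. b i j * (c i j * (y1 + z * y2) - (d1 i j + z * d2 i j)))
      = (\<Sum>i<s. \<Sum>j<t. b i j * (c i j * y1 - d1 i j)) + z * (\<Sum>i<s. \<Sum>j<t. b i j * (c i j * y2 - d2 i j))"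
      unfolding sum_distrib_left sum.distrib[symmetric]
      by (intro sum.cong refl) (simp add: algebra_simps)
    then show ?thesis by (simp add: algebra_simps)
  qed
  show ?thesis unfolding dual_form_def sum_distrib_left sum.distrib[symmetric]
    by (intro sum.cong refl) (simp only: poly_add poly_smult *)
qed

lemma dual_form_add_smult_left:
  "dual_form s t m x f w lam (\<lambda>i j. p1 i j + smult z (p2 i j)) (q1 + smult z q2) p q =
     dual_form s t m x f w lam p1 q1 p q + cnj z * dual_form s t m x f w lam p2 q2 p q"
  by (subst (1 2 3) dual_form_cnj) (simp add: dual_form_add_smult)

lemma dual_objective_smult:
  "dual_objective s t m x f w (\<lambda>i j. smult a (p i j)) (smult a q) = (cmod a)\<^sup>2 * dual_objective s t m x f w p q"
proof -
  have "(cmod (f i j (x l) * poly (smult a q) (x l) - poly (smult a (p i j)) (x l)))\<^sup>2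
    = (cmod a)\<^sup>2 * (cmod (f i j (x l) * poly q (x l) - poly (p i j) (x l)))\<^sup>2" for i j l
    by (simp add: power_mult_distrib[symmetric] norm_mult[symmetric] algebra_simps)
  then show ?thesis unfolding dual_objective_def
    by (simp add: sum_distrib_left algebra_simps)
qed

lemma dual_objective_nonneg:
  "\<forall>l<m. 0 \<le> w l \<Longrightarrow> 0 \<le> dual_objective s t m x f w p q"
  unfolding dual_objective_def by (auto intro!: sum_nonneg mult_nonneg_nonneg)

lemma dual_value_le:
  assumes "\<forall>l<m. 0 \<le> w l" "dual_feasible s t n d m x w p q"
  shows "dual_value s t n d m x f w \<le> dual_objective s t m x f w p q"
  unfolding dual_value_def
  by (rule cInf_lower) (use assms in \<open>auto intro!: bdd_belowI[of _ 0] dual_objective_nonneg\<close>)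

text \<open>Since the objective is quadratic, rescaling multiplies it by the squared modulus of the
  factor; the second fact supplies that number, so that inequalities can pass from normalized to
  arbitrary pairs.\<close>

lemma dual_feasible_normalize:
  assumes "\<forall>i<s. \<forall>j<t. p i j \<in> poly_space (n i j)" "q \<in> poly_space d"
    and pos: "0 < (\<Sum>l<m. w l * (cmod (poly q (x l)))\<^sup>2)" (is "0 < ?Q")
  defines "a \<equiv> complex_of_real (1 / sqrt (\<Sum>l<m. w l * (cmod (poly q (x l)))\<^sup>2))"
  shows "dual_feasible s t n d m x w (\<lambda>i j. smult a (p i j)) (smult a q)"
    and "(cmod a)\<^sup>2 = 1 / (\<Sum>l<m. w l * (cmod (poly q (x l)))\<^sup>2)"
proof -
  show a: "(cmod a)\<^sup>2 = 1 / ?Q" using pos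
    by (simp add: a_def norm_divide power_divide)
  have "(\<Sum>l<m. w l * (cmod (poly (smult a q) (x l)))\<^sup>2) = (cmod a)\<^sup>2 * ?Q"
    by (simp add: norm_mult power_mult_distrib sum_distrib_left algebra_simps)
  then show "dual_feasible s t n d m x w (\<lambda>i j. smult a (p i j)) (smult a q)"
    using assms(1,2) pos unfolding dual_feasible_def a
    by (auto simp: poly_space_def intro: order.trans[OF degree_smult_le])
qed

text \<open>Homogeneity extends the defining inequality of the infimum to all pairs. If the weighted
  norm of \<open>q\<close> vanishes, the pair cannot be normalized, but then the gap is the
  objective itself.\<close>

lemma weighted_gap_nonneg:
  assumes w: "\<forall>l<m. 0 \<le> w l"
    and pq: "\<forall>i<s. \<forall>j<t. p i j \<in> poly_space (n i j)" "q \<in> poly_space d"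
  shows "0 \<le> weighted_gap s t m x f w (dual_value s t n d m x f w) p q"
proof -
  let ?Q = "\<Sum>l<m. w l * (cmod (poly q (x l)))\<^sup>2"
  have "0 \<le> ?Q" using w by (auto intro!: sum_nonneg)
  then consider "?Q = 0" | "0 < ?Q" by linarith
  then show ?thesis
  proof cases
    case 1
    then show ?thesis using dual_objective_nonneg[OF w] by (simp add: weighted_gap_def)
  next
    case 2
    from dual_value_le[OF w dual_feasible_normalize(1)[where p = p and q = q, OF pq 2], where f = f] dual_feasible_normalize(2)[OF pq 2]
    have "dual_value s t n d m x f w \<le> dual_objective s t m x f w p q / ?Q"
      by (simp add: dual_objective_smult)
    with 2 show ?thesis by (simp add: weighted_gap_def field_simps)
  qed
qed

lemma nonneg_quadratic_imp_linear_zero: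
  fixes g :: complex and K :: real
  assumes "\<And>z. 0 \<le> 2 * Re (cnj z * g) + (cmod z)\<^sup>2 * K"
  shows "g = 0"
proof (rule ccontr)
  assume "g \<noteq> 0"
  \<comment> \<open>At \<open>z = - g / h\<close> the linear term is -2 |g|^2 / h and the quadratic
    term is |g|^2 / h times \<open>K / h < 1\<close>, so the sum is negative. The added 1 keeps
    \<open>h\<close> positive when \<open>K = 0\<close>.\<close>
  define h where "h = \<bar>K\<bar> + 1"
  have h: "h > 0" "K < h" by (auto simp: h_def)
  have "cnj (- (g / complex_of_real h)) * g = complex_of_real (- ((cmod g)\<^sup>2 / h))"
    using complex_norm_square[of g] by (simp add: mult.commute)
  then have "2 * Re (cnj (- (g / complex_of_real h)) * g) = - 2 * ((cmod g)\<^sup>2 / h)" by (simp only: Re_complex_of_real)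
  moreover have "(cmod (- (g / complex_of_real h)))\<^sup>2 * K = (cmod g)\<^sup>2 / h * (K / h)"
    using h by (simp add: norm_divide power2_eq_square)
  ultimately have "0 \<le> - 2 * ((cmod g)\<^sup>2 / h) + (cmod g)\<^sup>2 / h * (K / h)"
    using assms[of "- (g / complex_of_real h)"] by (simp only:)
  then have "0 \<le> (cmod g)\<^sup>2 / h * (K / h - 2)" by (simp only: algebra_simps)
  moreover have "(cmod g)\<^sup>2 / h > 0" using \<open>g \<noteq> 0\<close> h by simp
  ultimately have "2 \<le> K / h" unfolding zero_le_mult_iff by linarith
  then show False using h by (simp add: field_simps)
qed

text \<open>The gap is nonnegative everywhere and zero at a minimizer. Moving from the minimizer by
  \<open>z\<close> times a test pair therefore gives a nonnegative real quadratic in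
  \<open>z\<close> without constant term, whose linear coefficient must vanish. This is the weak
  form of the eigenvector equation.\<close>

lemma dual_minimizer_stationary:
  assumes w: "\<forall>l<m. 0 \<le> w l"
    and min: "dual_minimizer s t n d m x f w p q"
    and pq': "\<forall>i<s. \<forall>j<t. p' i j \<in> poly_space (n i j)" "q' \<in> poly_space d"
  shows "dual_form s t m x f w (dual_value s t n d m x f w) p' q' p q = 0"
proof (rule nonneg_quadratic_imp_linear_zero)
  fix z
  let ?lam = "dual_value s t n d m x f w"
  let ?G = "dual_form s t m x f w ?lam"
  let ?H = "weighted_gap s t m x f w ?lam"
  let ?p = "\<lambda>i j. p i j + smult z (p' i j)" and ?q = "q + smult z q'"
  have H0: "?H p q = 0" using min by (simp add: dual_minimizer_def dual_feasible_def weighted_gap_def)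
  have "\<forall>i<s. \<forall>j<t. ?p i j \<in> poly_space (n i j)" "?q \<in> poly_space d"
    using min pq' by (auto simp: dual_minimizer_def dual_feasible_def poly_space_def
        intro!: degree_add_le intro: order.trans[OF degree_smult_le])
  from weighted_gap_nonneg[OF w this]
  have "0 \<le> Re (?G ?p ?q ?p ?q)" unfolding dual_form_self by simp
  also have "?G ?p ?q ?p ?q = ?G p q p q + (cnj z * ?G p' q' p q + cnj (cnj z * ?G p' q' p q))
      + (z * cnj z) * ?G p' q' p' q'"
    unfolding dual_form_add_smult dual_form_add_smult_left
    by (subst dual_form_cnj[of _ _ _ _ _ _ _ p q p' q']) (simp add: algebra_simps)
  also have "\<dots> = complex_of_real (?H p q + 2 * Re (cnj z * ?G p' q' p q) + (cmod z)\<^sup>2 * ?H p' q')"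
    unfolding dual_form_self complex_add_cnj complex_norm_square[symmetric] by simp
  finally show "0 \<le> 2 * Re (cnj z * ?G p' q' p q) + (cmod z)\<^sup>2 * ?H p' q'"
    using H0 by simp
qed

subsection \<open>Kernels at a simple eigenvalue of a pencil\<close>

lemma det_const_poly_mat:
  fixes P :: "'a::comm_ring_1 mat"
  assumes "P \<in> carrier_mat N N"
  shows "det (map_mat (\<lambda>a. [:a:]) P) = [:det P:]"
proof -
  interpret comm_ring_hom "\<lambda>a::'a. [:a:]"
    by unfold_locales (auto simp: one_pCons)
  show ?thesis using hom_det[of P] by simp
qed

text \<open>The geometric multiplicity cannot exceed the algebraic one, so two kernel vectors are
  proportional. Proportionality is expressed by vanishing 2 by 2 minors, which treats all pairs of
  vectors uniformly and requires no dimension argument.\<close>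

lemma pencil_kernel_minor_zero:
  fixes A B :: "complex mat"
  assumes A: "A \<in> carrier_mat N N" and B: "B \<in> carrier_mat N N"
    and simple: "simple_pencil_eigenvalue A B lam"
    and u: "u \<in> carrier_vec N" "A *\<^sub>v u = lam \<cdot>\<^sub>v (B *\<^sub>v u)"
    and v: "v \<in> carrier_vec N" "A *\<^sub>v v = lam \<cdot>\<^sub>v (B *\<^sub>v v)"
    and i: "i < N" and j: "j < N"
  shows "u $ i * v $ j = u $ j * v $ i"
proof (rule ccontr)
  assume minor: "u $ i * v $ j \<noteq> u $ j * v $ i"
  then have ij: "i \<noteq> j" by auto
  let ?c = "\<lambda>a::complex. [:a:]"
  \<comment> \<open>With \<open>u\<close>, \<open>v\<close> as columns \<open>i\<close>, \<open>j\<close> of an invertible \<open>P\<close>, two columns of \<open>X * P\<close>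
    become divisible by \<open>z - lam\<close>, so \<open>lam\<close> would be at least a double root.\<close>
  define P where "P = mat N N (\<lambda>(r,c). if c = i then u $ r else if c = j then v $ r
    else if r = c then 1 else 0)"
  define X where "X = map_mat ?c A - [:0, 1:] \<cdot>\<^sub>m map_mat ?c B"
  define C where "C = mat N N (\<lambda>(r,c). if c = i then [:(B *\<^sub>v u) $ r:]
    else if c = j then [:(B *\<^sub>v v) $ r:] else X $$ (r,c))"
  define D where "D = mat N N (\<lambda>(r,c). if r = c then (if r = i \<or> r = j then [:lam,-1:] else 1) else 0)"
  have carr: "P \<in> carrier_mat N N" "X \<in> carrier_mat N N" "C \<in> carrier_mat N N" "D \<in> carrier_mat N N"
    using A B by (auto simp: P_def X_def C_def D_def)
  have "det P \<noteq> 0"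
  proof
    assume "det P = 0"
    then obtain y where y: "y \<in> carrier_vec N" "y \<noteq> 0\<^sub>v N" "P *\<^sub>v y = 0\<^sub>v N"
      using det_0_iff_vec_prod_zero[OF carr(1)] by auto
    have row: "(\<Sum>c<N. P $$ (r,c) * y $ c) = 0" if "r < N" for r
    proof -
      have "(P *\<^sub>v y) $ r = (\<Sum>c<N. P $$ (r,c) * y $ c)"
        using that carr(1) y(1) by (auto simp: scalar_prod_def lessThan_atLeast0 intro!: sum.cong)
      then show ?thesis using y(3) that by simp
    qed
    \<comment> \<open>Outside columns \<open>i\<close> and \<open>j\<close> the matrix
      \<open>P\<close> agrees with the identity. Rows \<open>i\<close> and \<open>j\<close> of
      \<open>P *\<^sub>v y\<close> therefore involve only \<open>y $ i\<close> and
      \<open>y $ j\<close>, and the other rows determine the remaining entries.\<close>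
    have split: "(\<Sum>c<N. P $$ (r,c) * y $ c)
        = u $ r * y $ i + v $ r * y $ j + (if r = i \<or> r = j then 0 else y $ r)"
      if "r < N" for r
    proof -
      have "(\<Sum>c<N. P $$ (r,c) * y $ c) =
        (\<Sum>c<N. (if c = i then u $ r * y $ i else 0) + (if c = j then v $ r * y $ j else 0)
           + (if c = r then (if r = i \<or> r = j then 0 else y $ r) else 0))"
        using that ij by (intro sum.cong) (auto simp: P_def)
      also have "\<dots> = u $ r * y $ i + v $ r * y $ j + (if r = i \<or> r = j then 0 else y $ r)"
        using that i j by (simp add: sum.distrib sum.delta)
      finally show ?thesis .
    qed
    have eq1: "u $ i * y $ i + v $ i * y $ j = 0" using row[OF i] split[OF i] by simp
    have eq2: "u $ j * y $ i + v $ j * y $ j = 0" using row[OF j] split[OF j] by simp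
    \<comment> \<open>Cramer's rule for the 2 by 2 system of rows \<open>i\<close> and
      \<open>j\<close>, whose determinant is the minor assumed to be nonzero.\<close>
    have "(u $ i * v $ j - u $ j * v $ i) * y $ i
        = v $ j * (u $ i * y $ i + v $ i * y $ j) - v $ i * (u $ j * y $ i + v $ j * y $ j)"
      by (simp add: algebra_simps)
    then have yi: "y $ i = 0" using eq1 eq2 minor by simp
    have "(u $ i * v $ j - u $ j * v $ i) * y $ j
        = u $ i * (u $ j * y $ i + v $ j * y $ j) - u $ j * (u $ i * y $ i + v $ i * y $ j)"
      by (simp add: algebra_simps)
    then have yj: "y $ j = 0" using eq1 eq2 minor by simp
    have "y $ r = 0" if "r < N" for r
      using row[OF that] split[OF that] yi yj by (auto split: if_splits)
    then have "y = 0\<^sub>v N" using y(1) by (intro eq_vecI) auto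
    with y(2) show False by simp
  qed
  have col_i: "col P i = u" and col_j: "col P j = v"
    using u(1) v(1) i j ij by (auto simp: P_def intro!: eq_vecI)
  \<comment> \<open>The eigenvector equations turn columns \<open>i\<close> and \<open>j\<close> of
    the product into \<open>lam - z\<close> times the constant columns \<open>B *\<^sub>v u\<close>
    and \<open>B *\<^sub>v v\<close>; \<open>D\<close> collects these two factors and
    \<open>C\<close> what is left.\<close>
  have mult: "X * map_mat ?c P = C * D"
  proof (rule eq_matI)
    fix r c assume "r < dim_row (C * D)" "c < dim_col (C * D)"
    then have rc: "r < N" "c < N" using carr by auto
    have XP: "(X * map_mat ?c P) $$ (r,c) = [:(A *\<^sub>v col P c) $ r, - ((B *\<^sub>v col P c) $ r):]"
    proof -
      have "(X * map_mat ?c P) $$ (r,c) = (\<Sum>k<N. X $$ (r,k) * [:P $$ (k,c):])"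
        using rc carr by (auto simp: scalar_prod_def lessThan_atLeast0 intro!: sum.cong)
      also have "\<dots> = (\<Sum>k<N. [:A $$ (r,k) * P $$ (k,c), - (B $$ (r,k) * P $$ (k,c)):])"
        using rc A B by (intro sum.cong) (auto simp: X_def)
      also have "\<dots> = [:\<Sum>k<N. A $$ (r,k) * P $$ (k,c), - (\<Sum>k<N. B $$ (r,k) * P $$ (k,c)):]"
        by (intro poly_eqI) (simp add: coeff_sum coeff_pCons sum_negf split: nat.split)
      also have "(\<Sum>k<N. A $$ (r,k) * P $$ (k,c)) = (A *\<^sub>v col P c) $ r"
        using rc A carr by (auto simp: scalar_prod_def lessThan_atLeast0 intro!: sum.cong)
      also have "(\<Sum>k<N. B $$ (r,k) * P $$ (k,c)) = (B *\<^sub>v col P c) $ r"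
        using rc B carr by (auto simp: scalar_prod_def lessThan_atLeast0 intro!: sum.cong)
      finally show ?thesis .
    qed
    have "(C * D) $$ (r,c) = (\<Sum>k<N. C $$ (r,k) * D $$ (k,c))"
      using rc carr by (auto simp: scalar_prod_def lessThan_atLeast0 intro!: sum.cong)
    also have "\<dots> = (\<Sum>k<N. if k = c then C $$ (r,c) * D $$ (c,c) else 0)"
      using rc by (intro sum.cong) (auto simp: D_def)
    finally have CD: "(C * D) $$ (r,c) = C $$ (r,c) * D $$ (c,c)" using rc by simp
    consider "c = i" | "c = j" | "c \<noteq> i" "c \<noteq> j" by blast
    then show "(X * map_mat ?c P) $$ (r,c) = (C * D) $$ (r,c)"
    proof cases
      case 1
      then show ?thesis unfolding XP CD using col_i rc u B by (simp add: C_def D_def)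
    next
      case 2
      then show ?thesis unfolding XP CD using col_j rc v B ij by (simp add: C_def D_def)
    next
      case 3
      have "col P c = unit_vec N c" using 3 rc by (auto simp: P_def unit_vec_def intro!: eq_vecI)
      then have "(A *\<^sub>v col P c) $ r = A $$ (r,c)" "(B *\<^sub>v col P c) $ r = B $$ (r,c)"
        using rc A B by auto
      then show ?thesis unfolding XP CD using 3 rc A B by (simp add: C_def D_def X_def)
    qed
  qed (use carr in auto)
  have "det D = (\<Prod>r = 0..<N. D $$ (r,r))"
    using carr(4) by (subst det_upper_triangular[OF _ carr(4)]) (auto simp: D_def prod_list_diag_prod)
  also have "\<dots> = (\<Prod>r\<in>{i,j}. [:lam,-1:])"
    using i j by (intro prod.mono_neutral_cong_right) (auto simp: D_def)
  \<comment> \<open>The two sign changes cancel, giving the monic linear factor by which the order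
    of a root is measured.\<close>
  also have "\<dots> = [:-lam,1:]^2" using ij by (simp add: power2_eq_square)
  finally have "det X * [:det P:] = det C * [:-lam,1:]^2"
    using mult carr det_mult[of X N "map_mat ?c P"] det_mult[of C N D]
    by (simp add: det_const_poly_mat)
  moreover have "det X * [:det P:] = smult (det P) (det X)" by simp
  ultimately have "[:-lam,1:]^2 dvd smult (det P) (det X)" by simp
  then have dvd: "[:-lam,1:]^2 dvd det X" using \<open>det P \<noteq> 0\<close> by (simp add: dvd_smult_iff)
  have "det X = pencil_char_poly A B" by (simp add: pencil_char_poly_def X_def)
  with simple dvd show False
    by (auto simp: simple_pencil_eigenvalue_def order_divides)
qed

subsection \<open>Block vectors\<close>

lemma mat_adjoint_index:
  fixes M :: "complex mat"
  assumes "i < dim_col M" "j < dim_row M"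
  shows "mat_adjoint M $$ (i,j) = cnj (M $$ (j,i))"
  using assms by (simp add: mat_adjoint_def mat_of_rows_def)

lemma mat_adjoint_carrier:
  fixes M :: "complex mat"
  shows "M \<in> carrier_mat nr nc \<Longrightarrow> mat_adjoint M \<in> carrier_mat nc nr"
  by (auto simp: mat_adjoint_def)

lemma conjugate_scalar_prod_adjoint:
  fixes M :: "complex mat"
  assumes M: "M \<in> carrier_mat nr nc" and u: "u \<in> carrier_vec nc" and y: "y \<in> carrier_vec nr"
  shows "conjugate u \<bullet> (mat_adjoint M *\<^sub>v y) = conjugate (M *\<^sub>v u) \<bullet> y"
proof -
  have "conjugate u \<bullet> (mat_adjoint M *\<^sub>v y) = (\<Sum>i<nc. \<Sum>j<nr. cnj (u $ i) * (cnj (M $$ (j,i)) * y $ j))"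
    using assms mat_adjoint_carrier[OF M]
    by (auto simp: scalar_prod_def lessThan_atLeast0 sum_distrib_left mat_adjoint_index intro!: sum.cong)
  also have "\<dots> = (\<Sum>j<nr. \<Sum>i<nc. cnj (u $ i) * (cnj (M $$ (j,i)) * y $ j))"
    by (rule sum.swap)
  also have "\<dots> = conjugate (M *\<^sub>v u) \<bullet> y"
    using assms by (auto simp: scalar_prod_def lessThan_atLeast0 sum_distrib_right mult.assoc intro!: sum.cong)
  finally show ?thesis .
qed

text \<open>The blocks are given by a function on a list of keys rather than by a list of vectors,
  so that linear operations act pointwise on the block function and blocks can be addressed by index
  pairs.\<close>

definition vstack :: "'b list \<Rightarrow> ('b \<Rightarrow> 'a::zero vec) \<Rightarrow> 'a vec" where
  "vstack ps c = foldr (\<lambda>a v. c a @\<^sub>v v) ps (0\<^sub>v 0)"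

lemma vstack_simps [simp]:
  "vstack [] c = 0\<^sub>v 0" "vstack (a # ps) c = c a @\<^sub>v vstack ps c"
  by (simp_all add: vstack_def)

lemma vstack_carrier:
  "(\<And>a. a \<in> set ps \<Longrightarrow> c a \<in> carrier_vec (N a)) \<Longrightarrow> vstack ps c \<in> carrier_vec (sum_list (map N ps))"
  by (induction ps) auto

lemma vstack_cong:
  "(\<And>a. a \<in> set ps \<Longrightarrow> c a = c' a) \<Longrightarrow> vstack ps c = vstack ps c'"
  by (induction ps) auto

lemma vstack_inject:
  assumes "\<And>a. a \<in> set ps \<Longrightarrow> c a \<in> carrier_vec (N a)" "\<And>a. a \<in> set ps \<Longrightarrow> c' a \<in> carrier_vec (N a)"
    and "vstack ps c = vstack ps c'" "a \<in> set ps"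
  shows "c a = c' a"
  using assms
proof (induction ps)
  case (Cons b ps)
  have "c b = c' b \<and> vstack ps c = vstack ps c'"
    using Cons.prems append_vec_eq[of "c b" "N b" "c' b"] by auto
  with Cons show ?case by (cases "a = b") auto
qed simp

lemma vstack_smult:
  fixes c :: "'b \<Rightarrow> complex vec"
  shows "z \<cdot>\<^sub>v vstack ps c = vstack ps (\<lambda>a. z \<cdot>\<^sub>v c a)"
proof (induction ps)
  case (Cons a ps)
  have "z \<cdot>\<^sub>v (c a @\<^sub>v vstack ps c) = (z \<cdot>\<^sub>v c a) @\<^sub>v (z \<cdot>\<^sub>v vstack ps c)"
    by (intro eq_vecI) auto
  with Cons show ?case by simp
qed auto

lemma vstack_add:
  fixes c c' :: "'b \<Rightarrow> complex vec"
  assumes "\<And>a. a \<in> set ps \<Longrightarrow> c a \<in> carrier_vec (N a)" "\<And>a. a \<in> set ps \<Longrightarrow> c' a \<in> carrier_vec (N a)"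
  shows "vstack ps c + vstack ps c' = vstack ps (\<lambda>a. c a + c' a)"
  using assms
proof (induction ps)
  case (Cons a ps)
  have "(c a @\<^sub>v vstack ps c) + (c' a @\<^sub>v vstack ps c') = (c a + c' a) @\<^sub>v (vstack ps c + vstack ps c')"
  proof -
    have "dim_vec (c a) = dim_vec (c' a)" "dim_vec (vstack ps c) = dim_vec (vstack ps c')"
      using Cons.prems(1)[of a] Cons.prems(2)[of a] vstack_carrier[of ps c N, OF Cons.prems(1)]
        vstack_carrier[of ps c' N, OF Cons.prems(2)] by auto
    then show ?thesis by (intro eq_vecI) auto
  qed
  with Cons show ?case by simp
qed auto

lemma vstack_surj:
  fixes u :: "'a::zero vec"
  assumes "distinct ps" "u \<in> carrier_vec (sum_list (map N ps))"
  obtains c where "\<And>a. a \<in> set ps \<Longrightarrow> c a \<in> carrier_vec (N a)" "u = vstack ps c"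
proof -
  have "\<exists>c. (\<forall>a\<in>set ps. c a \<in> carrier_vec (N a)) \<and> u = vstack ps c"
    using assms
  proof (induction ps arbitrary: u)
    case (Cons a ps)
    let ?k = "sum_list (map N ps)"
    from Cons obtain c where c: "\<forall>a\<in>set ps. c a \<in> carrier_vec (N a)" "vec_last u ?k = vstack ps c"
      by (metis distinct.simps(2) vec_last_carrier)
    have "u = vec_first u (N a) @\<^sub>v vec_last u ?k"
      using Cons.prems(2) by (intro vec_first_last_append[symmetric]) simp
    also have "\<dots> = vstack (a # ps) (c(a := vec_first u (N a)))"
    proof -
      \<comment> \<open>Overwriting the block at \<open>a\<close> leaves the tail unchanged because
        the keys are distinct.\<close>
      have "vstack ps c = vstack ps (c(a := vec_first u (N a)))"
        using Cons.prems(1) by (intro vstack_cong) auto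
      with c(2) show ?thesis by (simp del: fun_upd_apply add: fun_upd_same)
    qed
    finally have "u = vstack (a # ps) (c(a := vec_first u (N a)))" .
    moreover have "\<forall>b\<in>set (a # ps). (c(a := vec_first u (N a))) b \<in> carrier_vec (N b)"
      using c(1) by auto
    ultimately show ?case by blast
  qed auto
  then show ?thesis using that by blast
qed

lemma conjugate_vstack_scalar_prod:
  fixes c c' :: "'b \<Rightarrow> complex vec"
  assumes "\<And>a. a \<in> set ps \<Longrightarrow> c a \<in> carrier_vec (N a)" "\<And>a. a \<in> set ps \<Longrightarrow> c' a \<in> carrier_vec (N a)"
  shows "conjugate (vstack ps c) \<bullet> vstack ps c' = (\<Sum>a\<leftarrow>ps. conjugate (c a) \<bullet> c' a)"
  using assms
proof (induction ps)
  case (Cons a ps)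
  have "conjugate (c a @\<^sub>v vstack ps c) = conjugate (c a) @\<^sub>v conjugate (vstack ps c)"
    by (intro eq_vecI) auto
  then have "conjugate (c a @\<^sub>v vstack ps c) \<bullet> (c' a @\<^sub>v vstack ps c')
      = conjugate (c a) \<bullet> c' a + conjugate (vstack ps c) \<bullet> vstack ps c'"
    using Cons.prems vstack_carrier[of ps c N] vstack_carrier[of ps c' N]
    by (simp add: scalar_prod_append[of _ "N a" _ "sum_list (map N ps)"])
  with Cons show ?case by simp
qed auto

lemma diag_block_mat_mult_vstack:
  fixes A :: "'b \<Rightarrow> complex mat"
  assumes "\<And>a. a \<in> set ps \<Longrightarrow> A a \<in> carrier_mat (M a) (N a)" "\<And>a. a \<in> set ps \<Longrightarrow> c a \<in> carrier_vec (N a)"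
  shows "diag_block_mat (map A ps) *\<^sub>v vstack ps c = vstack ps (\<lambda>a. A a *\<^sub>v c a)"
  using assms
proof (induction ps)
  case (Cons a ps)
  let ?D = "diag_block_mat (map A ps)"
  have D: "?D \<in> carrier_mat (dim_row ?D) (sum_list (map N ps))"
  proof -
    have "sum_list (map (dim_col \<circ> A) ps) = sum_list (map N ps)"
      using Cons.prems(1) by (intro arg_cong[where f = sum_list] map_cong) auto
    then show ?thesis by (intro carrier_matI) (simp_all add: dim_diag_block_mat)
  qed
  have v: "vstack ps c \<in> carrier_vec (sum_list (map N ps))" using Cons.prems(2) by (intro vstack_carrier) auto
  have Aa: "A a \<in> carrier_mat (M a) (N a)" "c a \<in> carrier_vec (N a)" using Cons.prems by auto
  have dims: "dim_row (A a) = M a" "dim_col (A a) = N a" "dim_col ?D = sum_list (map N ps)"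
    using Aa(1) D by auto
  have "diag_block_mat (map A (a # ps)) *\<^sub>v vstack (a # ps) c
      = (A a *\<^sub>v c a + 0\<^sub>m (M a) (sum_list (map N ps)) *\<^sub>v vstack ps c)
        @\<^sub>v (0\<^sub>m (dim_row ?D) (N a) *\<^sub>v c a + ?D *\<^sub>v vstack ps c)"
    by (simp only: list.map diag_block_mat.simps Let_def vstack_simps dims
        four_block_mat_mult_vec[OF Aa(1) zero_carrier_mat zero_carrier_mat D Aa(2) v])
  also have "0\<^sub>m (M a) (sum_list (map N ps)) *\<^sub>v vstack ps c = 0\<^sub>v (M a)"
    using v by (intro eq_vecI) auto
  also have "0\<^sub>m (dim_row ?D) (N a) *\<^sub>v c a = 0\<^sub>v (dim_row ?D)"
    using Aa(2) by (intro eq_vecI) auto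
  also have "A a *\<^sub>v c a + 0\<^sub>v (M a) = A a *\<^sub>v c a"
    by (rule right_zero_vec[OF mult_mat_vec_carrier[OF Aa]])
  also have "0\<^sub>v (dim_row ?D) + ?D *\<^sub>v vstack ps c = ?D *\<^sub>v vstack ps c"
    by (rule left_zero_vec[OF mult_mat_vec_carrier[OF D v]])
  also have "?D *\<^sub>v vstack ps c = vstack ps (\<lambda>a. A a *\<^sub>v c a)"
    by (rule Cons.IH) (use Cons.prems in auto)
  finally show ?case by (simp only: vstack_simps)
qed auto

text \<open>Size and product are proved together: the induction step splits the product only once
  the size of the tail is known.\<close>

lemma append_rows_mult_vec:
  fixes A :: "'b \<Rightarrow> complex mat"
  assumes "\<And>a. a \<in> set ps \<Longrightarrow> A a \<in> carrier_mat (M a) N" "y \<in> carrier_vec N"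
  shows "foldr (@\<^sub>r) (map A ps) (0\<^sub>m 0 N) \<in> carrier_mat (sum_list (map M ps)) N
    \<and> foldr (@\<^sub>r) (map A ps) (0\<^sub>m 0 N) *\<^sub>v y = vstack ps (\<lambda>a. A a *\<^sub>v y)"
  using assms(1)
proof (induction ps)
  case Nil
  then show ?case by auto
next
  case (Cons a ps)
  then show ?case using mat_mult_append[of "A a" "M a" N _ "sum_list (map M ps)" y] assms(2) by auto
qed

lemma hcat_carrier:
  "A \<in> carrier_mat nr nc1 \<Longrightarrow> B \<in> carrier_mat nr nc2 \<Longrightarrow> hcat A B \<in> carrier_mat nr (nc1 + nc2)"
  by (auto simp: hcat_def)

lemma hcat_mult_vec:
  fixes A B :: "complex mat"
  assumes "A \<in> carrier_mat nr nc1" "B \<in> carrier_mat nr nc2" "a \<in> carrier_vec nc1" "b \<in> carrier_vec nc2"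
  shows "hcat A B *\<^sub>v (a @\<^sub>v b) = A *\<^sub>v a + B *\<^sub>v b"
proof -
  have "hcat A B *\<^sub>v (a @\<^sub>v b) = (A *\<^sub>v a + B *\<^sub>v b) @\<^sub>v (0\<^sub>m 0 nc1 *\<^sub>v a + 0\<^sub>m 0 nc2 *\<^sub>v b)"
    using four_block_mat_mult_vec[OF assms(1,2) zero_carrier_mat zero_carrier_mat assms(3,4)] assms(1,2)
    by (simp add: hcat_def)
  also have "\<dots> = A *\<^sub>v a + B *\<^sub>v b" by (intro eq_vecI) auto
  finally show ?thesis .
qed

section \<open>Coordinates in a polynomial basis and the order of the matrix entries\<close>

definition poly_comb :: "nat \<Rightarrow> (nat \<Rightarrow> complex poly) \<Rightarrow> complex vec \<Rightarrow> complex poly" where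
  "poly_comb N b c = (\<Sum>k\<le>N. smult (c $ k) (b k))"

lemma poly_comb_in_poly_space:
  assumes "poly_basis N b"
  shows "poly_comb N b c \<in> poly_space N"
  unfolding poly_comb_def poly_space_def mem_Collect_eq
  using assms by (intro degree_sum_le) (auto simp: poly_basis_def poly_space_def intro: order.trans[OF degree_smult_le])

lemma poly_comb_smult:
  "c \<in> carrier_vec (N + 1) \<Longrightarrow> poly_comb N b (z \<cdot>\<^sub>v c) = smult z (poly_comb N b c)"
  unfolding poly_comb_def smult_sum2 by (intro sum.cong) auto

lemma poly_comb_surj:
  assumes "poly_basis N b" "p \<in> poly_space N"
  obtains c where "c \<in> carrier_vec (N + 1)" "poly_comb N b c = p"
proof -
  from assms obtain c where c: "p = (\<Sum>k\<le>N. smult (c k) (b k))" unfolding poly_basis_def by blast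
  have "poly_comb N b (vec (N + 1) c) = p" unfolding poly_comb_def c by (intro sum.cong) auto
  then show ?thesis using that[of "vec (N + 1) c"] by simp
qed

lemma basis_mat_carrier: "basis_mat m x N b \<in> carrier_mat m (N + 1)"
  by (simp add: basis_mat_def)

lemma basis_mat_mult_vec:
  assumes "c \<in> carrier_vec (N + 1)"
  shows "basis_mat m x N b *\<^sub>v c = vec m (\<lambda>l. poly (poly_comb N b c) (x l))"
  using assms
  by (intro eq_vecI) (auto simp: basis_mat_def poly_comb_def scalar_prod_def poly_sum mult.commute
      lessThan_atLeast0[symmetric] lessThan_Suc_atMost intro!: sum.cong)

lemma mat_diag_mult_vec:
  fixes y :: "complex vec"
  shows "y \<in> carrier_vec m \<Longrightarrow> mat_diag m g *\<^sub>v y = vec m (\<lambda>l. g l * y $ l)"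
proof (rule eq_vecI)
  fix i assume y: "y \<in> carrier_vec m" and "i < dim_vec (vec m (\<lambda>l. g l * y $ l))"
  then have i: "i < m" by simp
  have "(mat_diag m g *\<^sub>v y) $ i = (\<Sum>k<m. (if i = k then g k else 0) * y $ k)"
    using y i by (auto simp: mat_diag_def scalar_prod_def lessThan_atLeast0 intro!: sum.cong)
  also have "\<dots> = (\<Sum>k<m. if k = i then g i * y $ i else 0)"
    by (intro sum.cong) auto
  finally show "(mat_diag m g *\<^sub>v y) $ i = vec m (\<lambda>l. g l * y $ l) $ i" using i by simp
qed (simp add: mat_diag_def)

lemma set_index_pairs: "set (index_pairs s t) = {..<s} \<times> {..<t}"
  by (auto simp: index_pairs_def)

lemma length_index_pairs: "length (index_pairs s t) = s * t"
  by (simp add: index_pairs_def length_concat o_def sum_list_triv)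

text \<open>The list has as many entries as its set has elements, which spares an argument about
  nested concatenation.\<close>

lemma distinct_index_pairs: "distinct (index_pairs s t)"
  by (rule card_distinct) (simp add: set_index_pairs length_index_pairs)

lemma sum_list_index_pairs:
  "(\<Sum>a\<leftarrow>index_pairs s t. g a) = (\<Sum>i<s. \<Sum>j<t. g (i,j) :: 'a::comm_monoid_add)"
  by (simp add: sum_list_distinct_conv_sum_set distinct_index_pairs set_index_pairs sum.cartesian_product)

subsection \<open>The pencil as a sesquilinear form\<close>

lemma data_stack_mult_vec:
  assumes "y \<in> carrier_vec m"
  shows "data_stack s t m x f \<in> carrier_mat (\<Sum>a\<leftarrow>index_pairs s t. m) m"
    and "data_stack s t m x f *\<^sub>v y = vstack (index_pairs s t) (\<lambda>(i,j). vec m (\<lambda>l. f i j (x l) * y $ l))"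
proof -
  let ?A = "\<lambda>(i,j). mat_diag m (\<lambda>l. f i j (x l))"
  have *: "data_stack s t m x f \<in> carrier_mat (\<Sum>a\<leftarrow>index_pairs s t. m) m \<and>
    data_stack s t m x f *\<^sub>v y = vstack (index_pairs s t) (\<lambda>a. ?A a *\<^sub>v y)"
    unfolding data_stack_def by (rule append_rows_mult_vec) (use assms in \<open>auto simp: mat_diag_def\<close>)
  then show "data_stack s t m x f \<in> carrier_mat (\<Sum>a\<leftarrow>index_pairs s t. m) m" by blast
  show "data_stack s t m x f *\<^sub>v y = vstack (index_pairs s t) (\<lambda>(i,j). vec m (\<lambda>l. f i j (x l) * y $ l))"
    unfolding conjunct2[OF *] using assms by (intro vstack_cong) (auto simp: mat_diag_mult_vec)
qed

text \<open>The factor [-Theta, F Phi] of A_w. It maps coefficient vectors to the stacked linearized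
  residuals at the nodes.\<close>

definition pencil_lhs ::
  "nat \<Rightarrow> nat \<Rightarrow> (nat \<Rightarrow> nat \<Rightarrow> nat) \<Rightarrow> nat \<Rightarrow> nat \<Rightarrow> (nat \<Rightarrow> complex) \<Rightarrow> (nat \<Rightarrow> nat \<Rightarrow> complex \<Rightarrow> complex)
     \<Rightarrow> (nat \<Rightarrow> nat \<Rightarrow> nat \<Rightarrow> complex poly) \<Rightarrow> (nat \<Rightarrow> complex poly) \<Rightarrow> complex mat" where
  "pencil_lhs s t n d m x f psi phi =
     hcat (- Theta_mat s t n m x psi) (data_stack s t m x f * basis_mat m x d phi)"

text \<open>The number of numerator coefficients, written as a list sum because this is the length
  that \<open>vstack\<close> produces; \<open>num_coeffs_eq\<close> relates it to the double sum in
  the pencil.\<close>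

definition num_coeffs :: "nat \<Rightarrow> nat \<Rightarrow> (nat \<Rightarrow> nat \<Rightarrow> nat) \<Rightarrow> nat" where
  "num_coeffs s t n = (\<Sum>(i,j)\<leftarrow>index_pairs s t. n i j + 1)"

lemma num_coeffs_eq: "num_coeffs s t n = (\<Sum>i<s. \<Sum>j<t. n i j + 1)"
  unfolding num_coeffs_def by (subst sum_list_index_pairs) simp

lemma Theta_mat_mult_vec:
  assumes "\<And>i j. i < s \<Longrightarrow> j < t \<Longrightarrow> c (i,j) \<in> carrier_vec (n i j + 1)"
  shows "Theta_mat s t n m x psi \<in> carrier_mat (\<Sum>a\<leftarrow>index_pairs s t. m) (num_coeffs s t n)"
    and "Theta_mat s t n m x psi *\<^sub>v vstack (index_pairs s t) c
      = vstack (index_pairs s t) (\<lambda>(i,j). vec m (\<lambda>l. poly (poly_comb (n i j) (psi i j) (c (i,j))) (x l)))"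
proof -
  have 1: "map (dim_row \<circ> (\<lambda>(i, j). basis_mat m x (n i j) (psi i j))) (index_pairs s t) = map (\<lambda>a. m) (index_pairs s t)"
    "map (dim_col \<circ> (\<lambda>(i, j). basis_mat m x (n i j) (psi i j))) (index_pairs s t) = map (\<lambda>(i,j). n i j + 1) (index_pairs s t)"
    by (auto simp: basis_mat_def)
  show "Theta_mat s t n m x psi \<in> carrier_mat (\<Sum>a\<leftarrow>index_pairs s t. m) (num_coeffs s t n)"
    unfolding Theta_mat_def num_coeffs_def
    by (rule carrier_matI) (simp_all only: dim_diag_block_mat map_map 1)
  have "Theta_mat s t n m x psi *\<^sub>v vstack (index_pairs s t) c
      = vstack (index_pairs s t) (\<lambda>a. (\<lambda>(i, j). basis_mat m x (n i j) (psi i j)) a *\<^sub>v c a)"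
    unfolding Theta_mat_def
    by (rule diag_block_mat_mult_vstack[where M = "\<lambda>_. m" and N = "\<lambda>(i,j). n i j + 1"])
       (auto simp: set_index_pairs assms[simplified] basis_mat_carrier[simplified])
  also have "\<dots> = vstack (index_pairs s t) (\<lambda>(i,j). vec m (\<lambda>l. poly (poly_comb (n i j) (psi i j) (c (i,j))) (x l)))"
    by (rule vstack_cong) (auto simp: set_index_pairs assms[simplified] basis_mat_mult_vec)
  finally show "Theta_mat s t n m x psi *\<^sub>v vstack (index_pairs s t) c
      = vstack (index_pairs s t) (\<lambda>(i,j). vec m (\<lambda>l. poly (poly_comb (n i j) (psi i j) (c (i,j))) (x l)))" .
qed

lemma pencil_lhs_carrier:
  "pencil_lhs s t n d m x f psi phi \<in> carrier_mat (\<Sum>a\<leftarrow>index_pairs s t. m) (num_coeffs s t n + (d + 1))"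
  unfolding pencil_lhs_def
  using Theta_mat_mult_vec(1)[of s t "\<lambda>(i,j). 0\<^sub>v (n i j + 1)" n m x psi]
    data_stack_mult_vec(1)[OF zero_carrier_vec, of s t m x f] basis_mat_carrier[of m x d phi]
  by (intro hcat_carrier mult_carrier_mat uminus_carrier_mat) auto

lemma pencil_lhs_mult_vec:
  assumes c: "\<And>i j. i < s \<Longrightarrow> j < t \<Longrightarrow> c (i,j) \<in> carrier_vec (n i j + 1)" and e: "e \<in> carrier_vec (d + 1)"
  shows "pencil_lhs s t n d m x f psi phi *\<^sub>v (vstack (index_pairs s t) c @\<^sub>v e)
    = vstack (index_pairs s t) (\<lambda>(i,j). vec m (\<lambda>l. f i j (x l) * poly (poly_comb d phi e) (x l)
         - poly (poly_comb (n i j) (psi i j) (c (i,j))) (x l)))"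
proof -
  let ?ps = "index_pairs s t" and ?T = "Theta_mat s t n m x psi" and ?D = "data_stack s t m x f"
  let ?P = "basis_mat m x d phi"
  let ?y = "vec m (\<lambda>l. poly (poly_comb d phi e) (x l))"
  let ?a = "\<lambda>(i,j). vec m (\<lambda>l. poly (poly_comb (n i j) (psi i j) (c (i,j))) (x l))"
  have T: "?T \<in> carrier_mat (\<Sum>a\<leftarrow>?ps. m) (num_coeffs s t n)" "?T *\<^sub>v vstack ?ps c = vstack ?ps ?a"
    subgoal by (intro Theta_mat_mult_vec(1)[where c = c] c)
    subgoal by (intro Theta_mat_mult_vec(2) c)
    done
  note D = data_stack_mult_vec[where y = ?y and s = s and t = t and m = m and x = x and f = f, OF vec_carrier]
  have v: "vstack ?ps c \<in> carrier_vec (num_coeffs s t n)"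
    unfolding num_coeffs_def by (rule vstack_carrier) (auto simp: set_index_pairs c[simplified])
  have "pencil_lhs s t n d m x f psi phi *\<^sub>v (vstack ?ps c @\<^sub>v e)
      = - ?T *\<^sub>v vstack ?ps c + (?D * ?P) *\<^sub>v e"
    unfolding pencil_lhs_def
    using T(1) D(1) basis_mat_carrier[of m x d phi] v e
    by (intro hcat_mult_vec[of _ "\<Sum>a\<leftarrow>?ps. m" "num_coeffs s t n" _ "d + 1"] mult_carrier_mat uminus_carrier_mat) auto
  also have "- ?T *\<^sub>v vstack ?ps c = - (?T *\<^sub>v vstack ?ps c)"
    using T(1) v by (intro eq_vecI) auto
  also have "\<dots> = (-1) \<cdot>\<^sub>v vstack ?ps ?a" unfolding T(2) by (intro eq_vecI) auto
  also have "\<dots> = vstack ?ps (\<lambda>a. (-1) \<cdot>\<^sub>v ?a a)" by (rule vstack_smult)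
  also have "(?D * ?P) *\<^sub>v e = ?D *\<^sub>v ?y"
    using assoc_mult_mat_vec[OF D(1) basis_mat_carrier e] by (simp add: basis_mat_mult_vec[OF e])
  also have "\<dots> = vstack ?ps (\<lambda>(i,j). vec m (\<lambda>l. f i j (x l) * ?y $ l))" by (rule D(2))
  also have "vstack ?ps (\<lambda>a. (-1) \<cdot>\<^sub>v ?a a) + \<dots>
      = vstack ?ps (\<lambda>a. (-1) \<cdot>\<^sub>v ?a a + (\<lambda>(i,j). vec m (\<lambda>l. f i j (x l) * ?y $ l)) a)"
    by (rule vstack_add[where N = "\<lambda>_. m"]) auto
  also have "\<dots> = vstack ?ps (\<lambda>(i,j). vec m (\<lambda>l. f i j (x l) * poly (poly_comb d phi e) (x l)
         - poly (poly_comb (n i j) (psi i j) (c (i,j))) (x l)))"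
    by (rule vstack_cong) (auto intro!: eq_vecI)
  finally show ?thesis .
qed

lemma weight_mat_mult_vec:
  "y \<in> carrier_vec m \<Longrightarrow> weight_mat m w *\<^sub>v y = vec m (\<lambda>l. complex_of_real (w l) * y $ l)"
  unfolding weight_mat_def by (rule mat_diag_mult_vec)

lemma weight_mat_carrier: "weight_mat m w \<in> carrier_mat m m"
  by (simp add: weight_mat_def mat_diag_def)

text \<open>Indexing the identical diagonal blocks by the index pairs makes the Kronecker product
  with the identity act blockwise on \<open>vstack\<close>.\<close>

lemma block_weight_mat_eq:
  "diag_block_mat (replicate (s * t) (weight_mat m w)) = diag_block_mat (map (\<lambda>_. weight_mat m w) (index_pairs s t))"
  by (simp add: map_replicate_const length_index_pairs)

lemma block_weight_mat_carrier:
  "diag_block_mat (replicate (s * t) (weight_mat m w)) \<in> carrier_mat (\<Sum>a\<leftarrow>index_pairs s t. m) (\<Sum>a\<leftarrow>index_pairs s t. m)"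
  using weight_mat_carrier[of m w]
  by (intro carrier_matI) (auto simp: dim_diag_block_mat sum_list_triv sum_list_replicate length_index_pairs)

lemma pencil_A_carrier:
  "pencil_A s t n d m x f psi phi w \<in> carrier_mat (num_coeffs s t n + (d + 1)) (num_coeffs s t n + (d + 1))"
  unfolding pencil_A_def Let_def pencil_lhs_def[symmetric]
  by (rule mult_carrier_mat[OF mult_carrier_mat[OF mat_adjoint_carrier[OF pencil_lhs_carrier]
        block_weight_mat_carrier] pencil_lhs_carrier])

text \<open>The adjoint factor moves to the left argument, so both sides of the weight matrix carry
  stacked linearized residuals, and the inner product splits into blocks. This is the numerator part
  of \<open>dual_form\<close>, up to the order of summation.\<close>

lemma pencil_A_form:
  assumes c: "\<And>i j. i < s \<Longrightarrow> j < t \<Longrightarrow> c (i,j) \<in> carrier_vec (n i j + 1)" and e: "e \<in> carrier_vec (d + 1)"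
    and c': "\<And>i j. i < s \<Longrightarrow> j < t \<Longrightarrow> c' (i,j) \<in> carrier_vec (n i j + 1)" and e': "e' \<in> carrier_vec (d + 1)"
  shows "conjugate (vstack (index_pairs s t) c' @\<^sub>v e') \<bullet>
      (pencil_A s t n d m x f psi phi w *\<^sub>v (vstack (index_pairs s t) c @\<^sub>v e))
    = (\<Sum>i<s. \<Sum>j<t. \<Sum>l<m.
         cnj (f i j (x l) * poly (poly_comb d phi e') (x l) - poly (poly_comb (n i j) (psi i j) (c' (i,j))) (x l))
       * (complex_of_real (w l) * (f i j (x l) * poly (poly_comb d phi e) (x l) - poly (poly_comb (n i j) (psi i j) (c (i,j))) (x l))))"
proof -
  let ?ps = "index_pairs s t" and ?M = "pencil_lhs s t n d m x f psi phi"
  let ?W = "diag_block_mat (replicate (s * t) (weight_mat m w))" and ?k = "\<Sum>a\<leftarrow>index_pairs s t. m"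
  let ?r = "\<lambda>c e (i,j). vec m (\<lambda>l. f i j (x l) * poly (poly_comb d phi e) (x l)
         - poly (poly_comb (n i j) (psi i j) (c (i,j))) (x l))"
  have v: "vstack ?ps c @\<^sub>v e \<in> carrier_vec (num_coeffs s t n + (d + 1))"
    unfolding num_coeffs_def by (intro append_carrier_vec vstack_carrier e) (auto simp: set_index_pairs c[simplified])
  have u: "vstack ?ps c' @\<^sub>v e' \<in> carrier_vec (num_coeffs s t n + (d + 1))"
    unfolding num_coeffs_def by (intro append_carrier_vec vstack_carrier e') (auto simp: set_index_pairs c'[simplified])
  have Mv: "?M *\<^sub>v (vstack ?ps c @\<^sub>v e) \<in> carrier_vec ?k"
    by (rule mult_mat_vec_carrier[OF pencil_lhs_carrier v])
  have "pencil_A s t n d m x f psi phi w *\<^sub>v (vstack ?ps c @\<^sub>v e)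
      = mat_adjoint ?M *\<^sub>v (?W *\<^sub>v (?M *\<^sub>v (vstack ?ps c @\<^sub>v e)))"
    unfolding pencil_A_def Let_def pencil_lhs_def[symmetric]
    by (simp only: assoc_mult_mat_vec[OF mult_carrier_mat[OF mat_adjoint_carrier[OF pencil_lhs_carrier] block_weight_mat_carrier] pencil_lhs_carrier v]
        assoc_mult_mat_vec[OF mat_adjoint_carrier[OF pencil_lhs_carrier] block_weight_mat_carrier Mv])
  then have "conjugate (vstack ?ps c' @\<^sub>v e') \<bullet> (pencil_A s t n d m x f psi phi w *\<^sub>v (vstack ?ps c @\<^sub>v e))
    = conjugate (?M *\<^sub>v (vstack ?ps c' @\<^sub>v e')) \<bullet> (?W *\<^sub>v (?M *\<^sub>v (vstack ?ps c @\<^sub>v e)))"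
    using conjugate_scalar_prod_adjoint[OF pencil_lhs_carrier u mult_mat_vec_carrier[OF block_weight_mat_carrier Mv]]
    by simp
  also have "?M *\<^sub>v (vstack ?ps c' @\<^sub>v e') = vstack ?ps (?r c' e')" by (intro pencil_lhs_mult_vec c' e')
  also have "?M *\<^sub>v (vstack ?ps c @\<^sub>v e) = vstack ?ps (?r c e)" by (intro pencil_lhs_mult_vec c e)
  also have "?W *\<^sub>v vstack ?ps (?r c e) = vstack ?ps (\<lambda>a. weight_mat m w *\<^sub>v ?r c e a)"
    unfolding block_weight_mat_eq
    by (rule diag_block_mat_mult_vstack[where M = "\<lambda>_. m" and N = "\<lambda>_. m"]) (auto intro: weight_mat_carrier)
  also have "conjugate (vstack ?ps (?r c' e')) \<bullet> \<dots> = (\<Sum>a\<leftarrow>?ps. conjugate (?r c' e' a) \<bullet> (weight_mat m w *\<^sub>v ?r c e a))"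
    by (rule conjugate_vstack_scalar_prod[where N = "\<lambda>_. m"])
       (auto intro!: mult_mat_vec_carrier[OF weight_mat_carrier])
  also have "\<dots> = (\<Sum>i<s. \<Sum>j<t. conjugate (?r c' e' (i,j)) \<bullet> (weight_mat m w *\<^sub>v ?r c e (i,j)))"
    by (rule sum_list_index_pairs)
  also have "\<dots> = (\<Sum>i<s. \<Sum>j<t. \<Sum>l<m.
         cnj (f i j (x l) * poly (poly_comb d phi e') (x l) - poly (poly_comb (n i j) (psi i j) (c' (i,j))) (x l))
       * (complex_of_real (w l) * (f i j (x l) * poly (poly_comb d phi e) (x l) - poly (poly_comb (n i j) (psi i j) (c (i,j))) (x l))))"
    by (intro sum.cong refl) (simp add: weight_mat_mult_vec scalar_prod_def lessThan_atLeast0)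
  finally show ?thesis .
qed

lemma pencil_B_carrier:
  "pencil_B s t n d m x phi w \<in> carrier_mat (num_coeffs s t n + (d + 1)) (num_coeffs s t n + (d + 1))"
  unfolding pencil_B_def Let_def num_coeffs_eq[symmetric]
  by (rule mult_carrier_mat[OF mult_carrier_mat[OF mat_adjoint_carrier[OF
        hcat_carrier[OF zero_carrier_mat basis_mat_carrier]] weight_mat_carrier]
        hcat_carrier[OF zero_carrier_mat basis_mat_carrier]])

text \<open>The zero block annihilates the numerator coefficients, so only the denominators
  remain.\<close>

lemma pencil_B_form:
  assumes v: "v \<in> carrier_vec (num_coeffs s t n)" and e: "e \<in> carrier_vec (d + 1)"
    and v': "v' \<in> carrier_vec (num_coeffs s t n)" and e': "e' \<in> carrier_vec (d + 1)"
  shows "conjugate (v' @\<^sub>v e') \<bullet> (pencil_B s t n d m x phi w *\<^sub>v (v @\<^sub>v e))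
    = (\<Sum>l<m. cnj (poly (poly_comb d phi e') (x l)) * (complex_of_real (w l) * poly (poly_comb d phi e) (x l)))"
proof -
  let ?M = "hcat (0\<^sub>m m (num_coeffs s t n)) (basis_mat m x d phi)"
  have M: "?M \<in> carrier_mat m (num_coeffs s t n + (d + 1))"
    by (intro hcat_carrier basis_mat_carrier zero_carrier_mat)
  have Mv: "?M *\<^sub>v (v @\<^sub>v e) = vec m (\<lambda>l. poly (poly_comb d phi e) (x l))"
    if "v \<in> carrier_vec (num_coeffs s t n)" "e \<in> carrier_vec (d + 1)" for v e
  proof -
    have "?M *\<^sub>v (v @\<^sub>v e) = 0\<^sub>m m (num_coeffs s t n) *\<^sub>v v + basis_mat m x d phi *\<^sub>v e"
      by (rule hcat_mult_vec[OF zero_carrier_mat basis_mat_carrier that])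
    also have "0\<^sub>m m (num_coeffs s t n) *\<^sub>v v = 0\<^sub>v m" using that(1) by (intro eq_vecI) auto
    finally show ?thesis by (simp add: basis_mat_mult_vec[OF that(2)])
  qed
  have cv: "v @\<^sub>v e \<in> carrier_vec (num_coeffs s t n + (d + 1))" "v' @\<^sub>v e' \<in> carrier_vec (num_coeffs s t n + (d + 1))"
    by (intro append_carrier_vec assms)+
  have Mc: "?M *\<^sub>v (v @\<^sub>v e) \<in> carrier_vec m" by (rule mult_mat_vec_carrier[OF M cv(1)])
  have "pencil_B s t n d m x phi w *\<^sub>v (v @\<^sub>v e) = mat_adjoint ?M *\<^sub>v (weight_mat m w *\<^sub>v (?M *\<^sub>v (v @\<^sub>v e)))"
    unfolding pencil_B_def Let_def num_coeffs_eq[symmetric]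
    by (simp only: assoc_mult_mat_vec[OF mult_carrier_mat[OF mat_adjoint_carrier[OF M] weight_mat_carrier] M cv(1)]
        assoc_mult_mat_vec[OF mat_adjoint_carrier[OF M] weight_mat_carrier Mc])
  then have "conjugate (v' @\<^sub>v e') \<bullet> (pencil_B s t n d m x phi w *\<^sub>v (v @\<^sub>v e))
    = conjugate (?M *\<^sub>v (v' @\<^sub>v e')) \<bullet> (weight_mat m w *\<^sub>v (?M *\<^sub>v (v @\<^sub>v e)))"
    using conjugate_scalar_prod_adjoint[OF M cv(2) mult_mat_vec_carrier[OF weight_mat_carrier Mc]] by simp
  then show ?thesis
    unfolding Mv[OF v e] Mv[OF v' e']
    by (simp add: weight_mat_mult_vec scalar_prod_def lessThan_atLeast0)
qed

text \<open>Every vector is the coefficient vector of some pair of polynomials, so stationarity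
  against all test pairs says that A v - lam B v is orthogonal to every vector. Testing with unit
  vectors gives the equation entry by entry.\<close>

lemma dual_minimizer_eigenvector:
  assumes psi: "\<forall>i<s. \<forall>j<t. poly_basis (n i j) (psi i j)" and phi: "poly_basis d phi"
    and w: "\<forall>l<m. 0 \<le> w l"
    and c: "\<And>i j. i < s \<Longrightarrow> j < t \<Longrightarrow> c (i,j) \<in> carrier_vec (n i j + 1)" and e: "e \<in> carrier_vec (d + 1)"
    and min: "dual_minimizer s t n d m x f w (\<lambda>i j. poly_comb (n i j) (psi i j) (c (i,j))) (poly_comb d phi e)"
  defines "v \<equiv> vstack (index_pairs s t) c @\<^sub>v e"
  shows "v \<in> carrier_vec (num_coeffs s t n + (d + 1))"
    and "pencil_A s t n d m x f psi phi w *\<^sub>v v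
      = complex_of_real (dual_value s t n d m x f w) \<cdot>\<^sub>v (pencil_B s t n d m x phi w *\<^sub>v v)"
proof -
  let ?K = "num_coeffs s t n + (d + 1)" and ?lam = "dual_value s t n d m x f w"
  let ?A = "pencil_A s t n d m x f psi phi w" and ?B = "pencil_B s t n d m x phi w"
  have v1: "vstack (index_pairs s t) c \<in> carrier_vec (num_coeffs s t n)"
    unfolding num_coeffs_def by (rule vstack_carrier) (auto simp: set_index_pairs c[simplified])
  show v: "v \<in> carrier_vec ?K" unfolding v_def by (intro append_carrier_vec v1 e)
  have Av: "?A *\<^sub>v v \<in> carrier_vec ?K" by (rule mult_mat_vec_carrier[OF pencil_A_carrier v])
  have Bv: "?B *\<^sub>v v \<in> carrier_vec ?K" by (rule mult_mat_vec_carrier[OF pencil_B_carrier v])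
  \<comment> \<open>An arbitrary test vector is cut into numerator blocks and denominator
    coefficients, which turns it back into a pair of polynomials.\<close>
  have orth: "conjugate u \<bullet> (?A *\<^sub>v v) = complex_of_real ?lam * (conjugate u \<bullet> (?B *\<^sub>v v))"
    if u: "u \<in> carrier_vec ?K" for u
  proof -
    define e' where "e' = vec_last u (d + 1)"
    have "vec_first u (num_coeffs s t n) \<in> carrier_vec (sum_list (map (\<lambda>(i,j). n i j + 1) (index_pairs s t)))"
      by (simp add: num_coeffs_def[symmetric, simplified])
    from vstack_surj[OF distinct_index_pairs this] obtain c' where
      c': "\<And>a. a \<in> set (index_pairs s t) \<Longrightarrow> c' a \<in> carrier_vec ((\<lambda>(i,j). n i j + 1) a)"
      and u1: "vec_first u (num_coeffs s t n) = vstack (index_pairs s t) c'" by blast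
    have c'': "c' (i,j) \<in> carrier_vec (n i j + 1)" if "i < s" "j < t" for i j
      using c'[of "(i,j)"] that by (simp add: set_index_pairs)
    have e': "e' \<in> carrier_vec (d + 1)" unfolding e'_def by (rule vec_last_carrier)
    have u_eq: "u = vstack (index_pairs s t) c' @\<^sub>v e'"
      unfolding u1[symmetric] e'_def by (rule vec_first_last_append[OF u, symmetric])
    have v1': "vstack (index_pairs s t) c' \<in> carrier_vec (num_coeffs s t n)"
      unfolding num_coeffs_def by (rule vstack_carrier) (rule c')
    let ?p' = "\<lambda>i j. poly_comb (n i j) (psi i j) (c' (i,j))" and ?q' = "poly_comb d phi e'"
    let ?p = "\<lambda>i j. poly_comb (n i j) (psi i j) (c (i,j))" and ?q = "poly_comb d phi e"
    have "0 = dual_form s t m x f w ?lam ?p' ?q' ?p ?q"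
      using psi phi by (intro dual_minimizer_stationary[symmetric, OF w min]) (auto intro!: poly_comb_in_poly_space)
    also have "\<dots> = (\<Sum>l<m. \<Sum>i<s. \<Sum>j<t. cnj (f i j (x l) * poly ?q' (x l) - poly (?p' i j) (x l)) *
          (complex_of_real (w l) * (f i j (x l) * poly ?q (x l) - poly (?p i j) (x l))))
        - complex_of_real ?lam * (\<Sum>l<m. cnj (poly ?q' (x l)) * (complex_of_real (w l) * poly ?q (x l)))"
    proof -
      have *: "a * ((\<Sum>i<s. \<Sum>j<t. g i j * h i j) - lam * (y * y'))
          = (\<Sum>i<s. \<Sum>j<t. g i j * (a * h i j)) - lam * (y * (a * y'))"
        for a lam y y' :: complex and g h :: "nat \<Rightarrow> nat \<Rightarrow> complex"
        by (simp add: right_diff_distrib sum_distrib_left mult.left_commute)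
      show ?thesis
        unfolding dual_form_def sum_subtractf * sum_distrib_left[where r = "complex_of_real ?lam"] ..
    qed
    also have "(\<Sum>l<m. \<Sum>i<s. \<Sum>j<t. cnj (f i j (x l) * poly ?q' (x l) - poly (?p' i j) (x l)) *
          (complex_of_real (w l) * (f i j (x l) * poly ?q (x l) - poly (?p i j) (x l))))
        = (\<Sum>i<s. \<Sum>j<t. \<Sum>l<m. cnj (f i j (x l) * poly ?q' (x l) - poly (?p' i j) (x l)) *
          (complex_of_real (w l) * (f i j (x l) * poly ?q (x l) - poly (?p i j) (x l))))"
      by (subst sum.swap) (intro sum.cong refl sum.swap)
    also have "\<dots> = conjugate u \<bullet> (?A *\<^sub>v v)"
      unfolding u_eq v_def by (intro pencil_A_form[symmetric] c c'' e e')
    also have "(\<Sum>l<m. cnj (poly ?q' (x l)) * (complex_of_real (w l) * poly ?q (x l))) = conjugate u \<bullet> (?B *\<^sub>v v)"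
      unfolding u_eq v_def by (rule pencil_B_form[OF v1 e v1' e', symmetric])
    finally show ?thesis by simp
  qed
  show "?A *\<^sub>v v = complex_of_real ?lam \<cdot>\<^sub>v (?B *\<^sub>v v)"
  proof (rule eq_vecI)
    fix i assume "i < dim_vec (complex_of_real ?lam \<cdot>\<^sub>v (?B *\<^sub>v v))"
    then have i: "i < ?K" using carrier_vecD[OF Bv] by (simp only: index_smult_vec)
    \<comment> \<open>Unit vectors are real, so conjugation leaves them fixed and the product reads
      off an entry.\<close>
    have unit: "conjugate (unit_vec ?K i) \<bullet> y = y $ i" if "y \<in> carrier_vec ?K" for y :: "complex vec"
    proof -
      have "conjugate (unit_vec ?K i) = (unit_vec ?K i :: complex vec)"
        by (intro eq_vecI) (auto simp: unit_vec_def)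
      then show ?thesis using scalar_prod_left_unit[OF that i] by simp
    qed
    show "(?A *\<^sub>v v) $ i = (complex_of_real ?lam \<cdot>\<^sub>v (?B *\<^sub>v v)) $ i"
      using orth[OF unit_vec_carrier, of i] carrier_vecD[OF Bv] i
      unfolding unit[OF Av] unit[OF Bv] by (simp only: index_smult_vec)
  qed (simp only: index_smult_vec carrier_vecD[OF Av] carrier_vecD[OF Bv])
qed

text \<open>Both minimizers give eigenvectors for the same simple eigenvalue, hence proportional
  coefficient vectors, and comparing blocks carries the factor over to the polynomials.\<close>

lemma dual_minimizer_unique:
  assumes psi: "\<forall>i<s. \<forall>j<t. poly_basis (n i j) (psi i j)" and phi: "poly_basis d phi"
    and w: "\<forall>l<m. 0 \<le> w l"
    and simple: "simple_pencil_eigenvalue (pencil_A s t n d m x f psi phi w) (pencil_B s t n d m x phi w)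
      (complex_of_real (dual_value s t n d m x f w))"
    and min: "dual_minimizer s t n d m x f w p q" and min': "dual_minimizer s t n d m x f w p' q'"
  shows "\<exists>z. q' = smult z q \<and> (\<forall>i<s. \<forall>j<t. p' i j = smult z (p i j))"
proof -
  let ?ps = "index_pairs s t"
  have coeffs: "\<exists>c e. (\<forall>i<s. \<forall>j<t. c (i,j) \<in> carrier_vec (n i j + 1) \<and> p i j = poly_comb (n i j) (psi i j) (c (i,j)))
      \<and> e \<in> carrier_vec (d + 1) \<and> q = poly_comb d phi e"
    if "dual_minimizer s t n d m x f w p q" for p q
  proof -
    from that have pq: "\<forall>i<s. \<forall>j<t. p i j \<in> poly_space (n i j)" "q \<in> poly_space d"
      by (auto simp: dual_minimizer_def dual_feasible_def)
    have "\<forall>i<s. \<forall>j<t. \<exists>c. c \<in> carrier_vec (n i j + 1) \<and> p i j = poly_comb (n i j) (psi i j) c"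
      using psi pq(1) poly_comb_surj by metis
    then obtain C where "\<forall>i<s. \<forall>j<t. C i j \<in> carrier_vec (n i j + 1) \<and> p i j = poly_comb (n i j) (psi i j) (C i j)"
      by metis
    moreover obtain e where "e \<in> carrier_vec (d + 1)" "poly_comb d phi e = q"
      using poly_comb_surj[OF phi pq(2)] by blast
    ultimately show ?thesis by (intro exI[of _ "\<lambda>(i,j). C i j"] exI[of _ e]) simp
  qed
  \<comment> \<open>Basis expansions agree with the numerators only for indices inside the matrix,
    and minimality depends on no other entries.\<close>
  have minimizer_cong: "dual_minimizer s t n d m x f w P Q \<Longrightarrow> dual_minimizer s t n d m x f w P' Q"
    if "\<forall>i<s. \<forall>j<t. P i j = P' i j" for P P' Q
    using that unfolding dual_minimizer_def dual_feasible_def dual_objective_def by simp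
  from coeffs[OF min] obtain c e where c: "\<forall>i<s. \<forall>j<t. c (i,j) \<in> carrier_vec (n i j + 1)"
    and p: "\<forall>i<s. \<forall>j<t. p i j = poly_comb (n i j) (psi i j) (c (i,j))"
    and e: "e \<in> carrier_vec (d + 1)" and q: "q = poly_comb d phi e" by blast
  from coeffs[OF min'] obtain c' e' where c': "\<forall>i<s. \<forall>j<t. c' (i,j) \<in> carrier_vec (n i j + 1)"
    and p': "\<forall>i<s. \<forall>j<t. p' i j = poly_comb (n i j) (psi i j) (c' (i,j))"
    and e': "e' \<in> carrier_vec (d + 1)" and q': "q' = poly_comb d phi e'" by blast
  define v where "v = vstack ?ps c @\<^sub>v e"
  define v' where "v' = vstack ?ps c' @\<^sub>v e'"
  let ?N = "num_coeffs s t n"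
  have V: "v \<in> carrier_vec (?N + (d + 1))" "pencil_A s t n d m x f psi phi w *\<^sub>v v
      = complex_of_real (dual_value s t n d m x f w) \<cdot>\<^sub>v (pencil_B s t n d m x phi w *\<^sub>v v)"
    unfolding v_def using c
    by (intro dual_minimizer_eigenvector[OF psi phi w _ e minimizer_cong[OF p min[unfolded q]]]; blast)+
  have V': "v' \<in> carrier_vec (?N + (d + 1))" "pencil_A s t n d m x f psi phi w *\<^sub>v v'
      = complex_of_real (dual_value s t n d m x f w) \<cdot>\<^sub>v (pencil_B s t n d m x phi w *\<^sub>v v')"
    unfolding v'_def using c'
    by (intro dual_minimizer_eigenvector[OF psi phi w _ e' minimizer_cong[OF p' min'[unfolded q']]]; blast)+
  have vs: "vstack ?ps c \<in> carrier_vec ?N"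
    unfolding num_coeffs_def using c by (intro vstack_carrier) (auto simp: set_index_pairs)
  have vs': "vstack ?ps c' \<in> carrier_vec ?N"
    unfolding num_coeffs_def using c' by (intro vstack_carrier) (auto simp: set_index_pairs)
  \<comment> \<open>The normalization excludes a zero denominator, so a nonzero denominator
    coefficient is available as pivot; its position in the stacked vector is shifted by the
    numerator coefficients.\<close>
  have "\<exists>k\<le>d. e $ k \<noteq> 0"
  proof (rule ccontr)
    assume "\<not> ?thesis"
    then have "q = 0" by (simp add: q poly_comb_def)
    then show False using min by (simp add: dual_minimizer_def dual_feasible_def)
  qed
  then obtain k where k: "k \<le> d" "e $ k \<noteq> 0" by blast
  define r where "r = ?N + k"
  have r: "r < ?N + (d + 1)" "v $ r \<noteq> 0" using k vs e by (auto simp: r_def v_def)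
  define z where "z = v' $ r / v $ r"
  have "v' = z \<cdot>\<^sub>v v"
  proof (rule eq_vecI)
    fix i assume "i < dim_vec (z \<cdot>\<^sub>v v)"
    then have i: "i < ?N + (d + 1)" using V(1) by simp
    \<comment> \<open>The minors through the pivot row \<open>r\<close> already determine all of
      \<open>v'\<close> from \<open>v\<close>.\<close>
    have "v $ i * v' $ r = v $ r * v' $ i"
      by (rule pencil_kernel_minor_zero[OF pencil_A_carrier pencil_B_carrier simple V V' i r(1)])
    then show "v' $ i = (z \<cdot>\<^sub>v v) $ i" using r(2) i V(1) by (simp add: z_def field_simps)
  qed (use V V' in simp)
  also have "z \<cdot>\<^sub>v v = (z \<cdot>\<^sub>v vstack ?ps c) @\<^sub>v (z \<cdot>\<^sub>v e)"
    unfolding v_def by (intro eq_vecI) auto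
  finally have "vstack ?ps c' = z \<cdot>\<^sub>v vstack ?ps c" "e' = z \<cdot>\<^sub>v e"
    unfolding v'_def using append_vec_eq[OF vs' smult_carrier_vec[THEN iffD2, OF vs]] by blast+
  then have "vstack ?ps c' = vstack ?ps (\<lambda>a. z \<cdot>\<^sub>v c a)" and e'_eq: "e' = z \<cdot>\<^sub>v e" by (simp_all add: vstack_smult)
  then have c'_eq: "c' (i,j) = z \<cdot>\<^sub>v c (i,j)" if "i < s" "j < t" for i j
    using c c' that
    by (intro vstack_inject[where ps = ?ps and c = c' and c' = "\<lambda>a. z \<cdot>\<^sub>v c a" and N = "\<lambda>(i,j). n i j + 1"])
       (auto simp: set_index_pairs)
  have "q' = smult z q" unfolding q q' e'_eq by (rule poly_comb_smult[OF e])
  moreover have "p' i j = smult z (p i j)" if "i < s" "j < t" for i j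
    using p p' c that c'_eq[OF that] by (simp add: poly_comb_smult)
  ultimately show ?thesis by blast
qed

subsection \<open>Weak duality\<close>

lemma quot_of_fract_Fract:
  fixes p q :: "complex poly"
  assumes "q \<noteq> 0"
  shows "fst (quot_of_fract (Fract p q)) * q = p * snd (quot_of_fract (Fract p q))"
proof -
  have "Fract (fst (quot_of_fract (Fract p q))) (snd (quot_of_fract (Fract p q))) = Fract p q"
    by (rule Fract_quot_of_fract)
  then show ?thesis using assms by (subst (asm) eq_fract(1)) simp_all
qed

text \<open>If the reduced denominator vanished at \<open>z\<close>, cross-multiplication with
  \<open>q\<close> nonzero there would make the reduced numerator vanish too, contradicting
  coprimality.\<close>

lemma not_has_pole_Fract:
  assumes "poly q z \<noteq> 0"
  shows "\<not> has_pole (Fract p q) z"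
proof
  assume pole: "has_pole (Fract p q) z"
  let ?a = "fst (quot_of_fract (Fract p q))" and ?b = "snd (quot_of_fract (Fract p q))"
  have "q \<noteq> 0" using assms by auto
  then have "poly (?a * q) z = poly (p * ?b) z" by (simp only: quot_of_fract_Fract[OF \<open>q \<noteq> 0\<close>])
  then have "poly ?a z = 0" "poly ?b z = 0" using pole assms by (auto simp: has_pole_def)
  then have "[:-z,1:] dvd ?a" "[:-z,1:] dvd ?b" by (simp_all add: poly_eq_0_iff_dvd)
  then have "is_unit [:-z,1:]" using coprime_quot_of_fract[of "Fract p q"] by (meson coprime_common_divisor)
  then show False by (simp add: is_unit_pCons_iff)
qed

text \<open>This also holds at a common zero of \<open>p\<close> and \<open>q\<close>, so fractions never have to be reduced.\<close>

lemma poly_eq_rat_eval_mult: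
  assumes "q \<noteq> 0" "\<not> has_pole (Fract p q) z"
  shows "poly p z = rat_eval (Fract p q) z * poly q z"
proof -
  let ?a = "fst (quot_of_fract (Fract p q))" and ?b = "snd (quot_of_fract (Fract p q))"
  have "poly (?a * q) z = poly (p * ?b) z" by (simp only: quot_of_fract_Fract[OF assms(1)])
  then show ?thesis using assms(2) by (simp add: has_pole_def rat_eval_def field_simps)
qed

lemma residual_nonneg: "0 \<le> residual s t f R z"
  unfolding residual_def frob_norm_def by (intro real_sqrt_ge_zero sum_nonneg) auto

text \<open>Entrywise f q - p = (f - r) q. Poles are excluded at \<open>z\<close>, but
  \<open>q\<close> may vanish there, so the identity also covers competitors whose common zeros
  cancel.\<close>

lemma node_error_eq_residual:
  assumes "q \<noteq> 0" "\<forall>i<s. \<forall>j<t. \<not> has_pole (Fract (p i j) q) z"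
  shows "(\<Sum>i<s. \<Sum>j<t. (cmod (f i j z * poly q z - poly (p i j) z))\<^sup>2)
    = (residual s t f (ratmat s t p q) z)\<^sup>2 * (cmod (poly q z))\<^sup>2"
proof -
  have "(residual s t f (ratmat s t p q) z)\<^sup>2
      = (\<Sum>i<s. \<Sum>j<t. (cmod (f i j z - rat_eval (Fract (p i j) q) z))\<^sup>2)"
    unfolding residual_def frob_norm_def
    by (subst real_sqrt_pow2) (auto simp: data_mat_def ratmat_def intro!: sum_nonneg sum.cong)
  moreover have "(cmod (f i j z * poly q z - poly (p i j) z))\<^sup>2
      = (cmod (f i j z - rat_eval (Fract (p i j) q) z))\<^sup>2 * (cmod (poly q z))\<^sup>2" if "i < s" "j < t" for i j
    using poly_eq_rat_eval_mult[OF assms(1), of "p i j" z] assms(2) that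
    by (simp add: power_mult_distrib[symmetric] norm_mult[symmetric] left_diff_distrib)
  ultimately show ?thesis by (simp add: sum_distrib_right)
qed

text \<open>A nonzero polynomial of degree at most \<open>d\<close> cannot vanish at more than
  \<open>d\<close> distinct nodes, and the support has more.\<close>

lemma weighted_norm_pos:
  assumes w: "\<forall>l<m. 0 \<le> w l" and inj: "inj_on x {..<m}" and card: "d < card (weight_support m w)"
    and q: "q \<in> poly_space d" "q \<noteq> 0"
  shows "0 < (\<Sum>l<m. w l * (cmod (poly q (x l)))\<^sup>2)"
proof (rule ccontr)
  assume "\<not> ?thesis"
  moreover have "0 \<le> (\<Sum>l<m. w l * (cmod (poly q (x l)))\<^sup>2)" using w by (auto intro!: sum_nonneg)
  ultimately have "(\<Sum>l<m. w l * (cmod (poly q (x l)))\<^sup>2) = 0" by linarith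
  then have "\<forall>l\<in>{..<m}. w l * (cmod (poly q (x l)))\<^sup>2 = 0"
    using w by (subst (asm) sum_nonneg_eq_0_iff) auto
  then have "x ` weight_support m w \<subseteq> {z. poly q z = 0}" by (auto simp: weight_support_def)
  then have "card (x ` weight_support m w) \<le> card {z. poly q z = 0}"
    using q(2) by (intro card_mono poly_roots_finite)
  also have "\<dots> \<le> degree q" using q(2) by (rule poly_roots_degree)
  also have "card (x ` weight_support m w) = card (weight_support m w)"
    by (rule card_image[OF inj_on_subset[OF inj]]) (auto simp: weight_support_def)
  finally show False using card q(1) by (simp add: poly_space_def)
qed

text \<open>For a competitor with finite error the weighted objective is an average of squared node
  errors against the weights w |q|^2, hence at most the maximal error times the total mass, and at
  least the dual value times it. The mass is positive and cancels.\<close>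

lemma dual_value_le_max_sq_error:
  assumes w: "\<forall>l<m. 0 \<le> w l" and inj: "inj_on x {..<m}" and card: "d < card (weight_support m w)"
    and R: "R \<in> ratmats s t n d"
  shows "ereal (dual_value s t n d m x f w) \<le> max_sq_error s t m x f R"
proof (cases "max_sq_error s t m x f R = \<infinity>")
  case False
  from R obtain p q where R_eq: "R = ratmat s t p q" and p: "\<forall>i<s. \<forall>j<t. p i j \<in> poly_space (n i j)"
    and q: "q \<in> poly_space d" "q \<noteq> 0" by (auto simp: ratmats_def)
  have sq_error_le: "sq_error s t f R (x l) \<le> max_sq_error s t m x f R" if "l < m" for l
    unfolding max_sq_error_def using that by (intro Max_ge) auto
  have no_pole: "\<forall>i<s. \<forall>j<t. \<not> has_pole (Fract (p i j) q) (x l)" if "l < m" for l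
  proof -
    have "sq_error s t f R (x l) \<noteq> \<infinity>" using sq_error_le[OF that] False by auto
    then show ?thesis unfolding sq_error_def R_eq ratmat_def by (auto split: if_splits)
  qed
  have res: "ereal ((residual s t f R (x l))\<^sup>2) \<le> max_sq_error s t m x f R" if "l < m" for l
    using sq_error_le[OF that] no_pole[OF that] unfolding sq_error_def
    by (auto simp: R_eq ratmat_def split: if_splits)
  \<comment> \<open>With at least one node the maximum dominates a real number, which excludes the
    value minus infinity.\<close>
  have "m \<noteq> 0" using card by (cases "m = 0") (auto simp: weight_support_def)
  then have "max_sq_error s t m x f R \<noteq> -\<infinity>" using res[of 0] by auto
  with False obtain e where e: "max_sq_error s t m x f R = ereal e" by (cases "max_sq_error s t m x f R") auto
  let ?Q = "\<Sum>l<m. w l * (cmod (poly q (x l)))\<^sup>2"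
  have "dual_value s t n d m x f w * ?Q \<le> dual_objective s t m x f w p q"
    using weighted_gap_nonneg[OF w p q(1), where f = f and x = x] by (simp add: weighted_gap_def)
  also have "\<dots> = (\<Sum>l<m. w l * ((residual s t f R (x l))\<^sup>2 * (cmod (poly q (x l)))\<^sup>2))"
    unfolding dual_objective_def R_eq by (intro sum.cong refl) (simp add: node_error_eq_residual q(2) no_pole)
  also have "\<dots> \<le> (\<Sum>l<m. w l * (e * (cmod (poly q (x l)))\<^sup>2))"
    using w res e by (intro sum_mono mult_left_mono mult_right_mono) auto
  also have "\<dots> = e * ?Q" by (simp add: sum_distrib_left mult.left_commute)
  finally show ?thesis using weighted_norm_pos[OF w inj card q] e by simp
qed auto

subsection \<open>Growth of the dual value\<close>

text \<open>The contribution of one node without its weight, so that the same quantity can be summed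
  against both the old and the updated weights.\<close>

definition node_gap ::
  "nat \<Rightarrow> nat \<Rightarrow> (nat \<Rightarrow> nat \<Rightarrow> complex \<Rightarrow> complex) \<Rightarrow> real
     \<Rightarrow> (nat \<Rightarrow> nat \<Rightarrow> complex poly) \<Rightarrow> complex poly \<Rightarrow> complex \<Rightarrow> real" where
  "node_gap s t f lam p q z =
     (\<Sum>i<s. \<Sum>j<t. (cmod (f i j z * poly q z - poly (p i j) z))\<^sup>2) - lam * (cmod (poly q z))\<^sup>2"

lemma weighted_gap_eq_sum_node_gap:
  "weighted_gap s t m x f w lam p q = (\<Sum>l<m. w l * node_gap s t f lam p q (x l))"
  unfolding weighted_gap_def node_gap_def dual_objective_def
  by (simp add: sum_subtractf right_diff_distrib sum_distrib_left mult.left_commute)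

lemma powr_difference_quotient_tendsto_ln:
  fixes a :: real
  assumes "0 < a" "b \<longlonglongrightarrow> 0" "\<And>k. b k \<noteq> 0"
  shows "(\<lambda>k. (a powr b k - 1) / b k) \<longlonglongrightarrow> ln a"
proof -
  have "((\<lambda>h. a powr h) has_real_derivative ln a) (at 0)"
    using assms(1) by (auto intro!: derivative_eq_intros)
  then have "((\<lambda>h. (a powr h - 1) / h) \<longlongrightarrow> ln a) (at 0)"
    using assms(1) by (simp add: DERIV_def)
  moreover have "filterlim b (at 0) sequentially"
    using assms(2,3) by (auto simp: filterlim_at)
  ultimately show ?thesis by (rule filterlim_compose)
qed

section \<open>Compactness of near-minimizers\<close>

lemma Bseq_of_weighted_square_bound:
  fixes y :: "nat \<Rightarrow> complex" and v :: "nat \<Rightarrow> real"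
  assumes v: "v \<longlonglongrightarrow> a" "0 < a" and pos: "\<And>k. 0 < v k" and bound: "\<And>k. v k * (cmod (y k))\<^sup>2 \<le> K"
  shows "Bseq y"
proof -
  have "(\<lambda>k. K / v k) \<longlonglongrightarrow> K / a" using v by (intro tendsto_intros) auto
  then have "Bseq (\<lambda>k. K / v k)" by (intro convergent_imp_Bseq) (auto simp: convergent_def)
  then obtain B where B: "\<And>k. \<bar>K / v k\<bar> \<le> B" unfolding Bseq_def by auto
  have "cmod (y k) \<le> B + 1" for k
  proof -
    have "(cmod (y k))\<^sup>2 \<le> K / v k" using bound[of k] pos[of k] by (simp add: field_simps)
    then have "(cmod (y k))\<^sup>2 \<le> B" using B[of k] by linarith
    \<comment> \<open>This follows from (|y| - 1)^2 >= 0 and turns the bound on the square into one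
      on the modulus without square roots.\<close>
    moreover have "cmod (y k) \<le> (cmod (y k))\<^sup>2 + 1"
      using zero_le_power2[of "cmod (y k) - 1"] norm_ge_zero[of "y k"]
      unfolding power2_eq_square left_diff_distrib right_diff_distrib by linarith
    ultimately show ?thesis by linarith
  qed
  then show ?thesis by (rule BseqI')
qed

text \<open>Supplies pairs within any margin of the infimum; the given feasible pair ensures that
  the infimum is taken over a nonempty set.\<close>

lemma near_minimizer_exists:
  assumes w: "\<forall>l<m. 0 \<le> w l" and feas: "dual_feasible s t n d m x w p q"
    and less: "dual_value s t n d m x f w < K"
  obtains p' q' where "dual_feasible s t n d m x w p' q'" "dual_objective s t m x f w p' q' < K"
proof -
  let ?S = "{dual_objective s t m x f w p q | p q. dual_feasible s t n d m x w p q}"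
  have "?S \<noteq> {}" using feas by auto
  from cInf_lessD[OF this, of K] less that show ?thesis unfolding dual_value_def by auto
qed

text \<open>At nodes of \<open>J\<close> the weights have positive limits, so the constraint bounds
  the denominators there and the objective bounds f Q - P, hence also the numerators.
  \<open>J\<close> has more nodes than any of the degrees, so these bounds give convergent
  subsequences.\<close>

lemma near_minimizers_convergent_subseq:
  fixes W :: "nat \<Rightarrow> nat \<Rightarrow> real"
  assumes inj: "inj_on x {..<m}"
    and d: "d < card J" and n: "\<And>i j. i < s \<Longrightarrow> j < t \<Longrightarrow> n i j < card J"
    and J: "J \<subseteq> {..<m}" and W: "\<And>l. l \<in> J \<Longrightarrow> (\<lambda>k. W k l) \<longlonglongrightarrow> w l" "\<And>l. l \<in> J \<Longrightarrow> 0 < w l"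
    and W_pos: "\<And>k l. l \<in> J \<Longrightarrow> 0 < W k l" and W_nonneg: "\<And>k l. l < m \<Longrightarrow> 0 \<le> W k l"
    and feas: "\<And>k. dual_feasible s t n d m x (W k) (P k) (Q k)"
    and bound: "\<And>k. dual_objective s t m x f (W k) (P k) (Q k) \<le> K"
  shows "\<exists>r p q. strict_mono (r :: nat \<Rightarrow> nat) \<and>
    (\<forall>i<s. \<forall>j<t. p i j \<in> poly_space (n i j)) \<and> q \<in> poly_space d \<and>
    (\<forall>i<s. \<forall>j<t. \<forall>z. (\<lambda>k. poly (P (r k) i j) z) \<longlonglongrightarrow> poly (p i j) z) \<and>
    (\<forall>z. (\<lambda>k. poly (Q (r k)) z) \<longlonglongrightarrow> poly q z)"
proof -
  have finJ: "finite J" using J by (rule finite_subset) simp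
  have card: "card (x ` J) = card J" by (rule card_image[OF inj_on_subset[OF inj J]])
  have Q_bdd: "Bseq (\<lambda>k. poly (Q k) (x l))" if l: "l \<in> J" for l
  proof (rule Bseq_of_weighted_square_bound[OF W(1)[OF l] W(2)[OF l] W_pos[OF l]])
    fix k
    have "W k l * (cmod (poly (Q k) (x l)))\<^sup>2 \<le> (\<Sum>l<m. W k l * (cmod (poly (Q k) (x l)))\<^sup>2)"
      using l J W_nonneg by (intro member_le_sum) auto
    then show "W k l * (cmod (poly (Q k) (x l)))\<^sup>2 \<le> 1" using feas[of k] by (simp add: dual_feasible_def)
  qed
  have P_bdd: "Bseq (\<lambda>k. poly (P k i j) (x l))" if l: "l \<in> J" and ij: "i < s" "j < t" for i j l
  proof -
    let ?y = "\<lambda>k. f i j (x l) * poly (Q k) (x l) - poly (P k i j) (x l)"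
    have "Bseq ?y"
    proof (rule Bseq_of_weighted_square_bound[OF W(1)[OF l] W(2)[OF l] W_pos[OF l]])
      fix k
      let ?g = "\<lambda>l i j. (cmod (f i j (x l) * poly (Q k) (x l) - poly (P k i j) (x l)))\<^sup>2"
      have "?g l i j \<le> (\<Sum>j<t. ?g l i j)" using ij by (intro member_le_sum) auto
      also have "\<dots> \<le> (\<Sum>i<s. \<Sum>j<t. ?g l i j)"
        using ij by (intro member_le_sum) (auto intro!: sum_nonneg)
      finally have "W k l * ?g l i j \<le> W k l * (\<Sum>i<s. \<Sum>j<t. ?g l i j)"
        using W_pos[OF l] by (intro mult_left_mono) (auto intro: less_imp_le)
      also have "\<dots> \<le> (\<Sum>l<m. W k l * (\<Sum>i<s. \<Sum>j<t. ?g l i j))"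
        using l J W_nonneg by (intro member_le_sum) (auto intro!: sum_nonneg mult_nonneg_nonneg)
      also have "\<dots> \<le> K" using bound[of k] by (simp add: dual_objective_def)
      finally show "W k l * ?g l i j \<le> K" .
    qed
    then obtain A where A: "\<And>k. cmod (?y k) \<le> A" unfolding Bseq_def by blast
    obtain B where B: "\<And>k. cmod (poly (Q k) (x l)) \<le> B" using Q_bdd[OF l] unfolding Bseq_def by blast
    have "cmod (poly (P k i j) (x l)) \<le> cmod (f i j (x l)) * B + A" for k
    proof -
      have "cmod (poly (P k i j) (x l)) \<le> cmod (f i j (x l)) * cmod (poly (Q k) (x l)) + cmod (?y k)"
        using norm_triangle_ineq4[of "f i j (x l) * poly (Q k) (x l)" "?y k"] by (simp add: norm_mult)
      also have "\<dots> \<le> cmod (f i j (x l)) * B + A" by (intro add_mono mult_left_mono A B) auto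
      finally show ?thesis .
    qed
    then show ?thesis by (rule BseqI')
  qed
  \<comment> \<open>The option type merges the denominator (\<open>None\<close>) and all numerators
    into one family, so that a single subsequence serves them all.\<close>
  define F where "F a k = (case a of None \<Rightarrow> Q k | Some (i,j) \<Rightarrow> P k i j)" for a k
  define N where "N a = (case a of None \<Rightarrow> d | Some (i,j) \<Rightarrow> n i j)" for a
  let ?I = "insert None (Some ` ({..<s} \<times> {..<t}))"
  have "\<exists>r L. strict_mono (r :: nat \<Rightarrow> nat) \<and>
      (\<forall>i\<in>?I. L i \<in> poly_space (N i) \<and> (\<forall>z. (\<lambda>k. poly (F i (r k)) z) \<longlonglongrightarrow> poly (L i) z))"
  proof (rule poly_family_convergent_subseq)
    show "finite (x ` J)" using finJ by simp
  qed (use feas P_bdd Q_bdd d n card in \<open>auto simp: F_def N_def dual_feasible_def\<close>)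
  then obtain r L where r: "strict_mono (r :: nat \<Rightarrow> nat)"
    and L: "\<And>i. i \<in> ?I \<Longrightarrow> L i \<in> poly_space (N i)"
      "\<And>i z. i \<in> ?I \<Longrightarrow> (\<lambda>k. poly (F i (r k)) z) \<longlonglongrightarrow> poly (L i) z" by blast
  show ?thesis
  proof (intro exI[of _ r] exI[of _ "\<lambda>i j. L (Some (i,j))"] exI[of _ "L None"] conjI allI impI)
    fix i j assume ij: "i < s" "j < t"
    show "(\<lambda>k. poly (P (r k) i j) z) \<longlonglongrightarrow> poly (L (Some (i, j))) z" for z
      using L(2)[of "Some (i,j)" z] ij by (simp add: F_def)
    show "L (Some (i, j)) \<in> poly_space (n i j)"
      using L(1)[of "Some (i,j)"] ij by (simp add: N_def)
  next
    show "(\<lambda>k. poly (Q (r k)) z) \<longlonglongrightarrow> poly (L None) z" for z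
      using L(2)[of None z] by (simp add: F_def)
    show "L None \<in> poly_space d" using L(1)[of None] by (simp add: N_def)
  qed (rule r)
qed

text \<open>By hypothesis \<open>zero\<close>, replacing \<open>ln (tau l)\<close> with
  \<open>ln (tau l) - ln c\<close> does not change the sum. Logarithm and square are both increasing
  on positive numbers, so each new term is nonnegative, and the term at \<open>l0\<close> is
  positive.\<close>

lemma log_weighted_gap_pos:
  fixes w tau g :: "nat \<Rightarrow> real"
  assumes w: "\<forall>l<m. 0 \<le> w l" and J: "J = weight_support m w" and tau: "\<forall>l\<in>J. 0 < tau l"
    and c: "0 < c" and g: "\<forall>l<m. 0 < g l" and l0: "l0 \<in> J" "tau l0 \<noteq> c"
    and zero: "(\<Sum>l<m. w l * (((tau l)\<^sup>2 - c\<^sup>2) * g l)) = 0"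
  shows "0 < (\<Sum>l<m. w l * (ln (tau l) * (((tau l)\<^sup>2 - c\<^sup>2) * g l)))"
proof -
  have sign: "0 < (ln a - ln c) * (a\<^sup>2 - c\<^sup>2)" if "0 < a" "a \<noteq> c" for a
  proof (cases "a < c")
    case True
    then have "ln a < ln c" "a\<^sup>2 < c\<^sup>2" using that c by (auto intro: power_strict_mono)
    then show ?thesis by (intro mult_neg_neg) auto
  next
    case False
    then have "ln c < ln a" "c\<^sup>2 < a\<^sup>2" using that c by (auto intro: power_strict_mono)
    then show ?thesis by (intro mult_pos_pos) auto
  qed
  have "0 < (\<Sum>l<m. w l * ((ln (tau l) - ln c) * (((tau l)\<^sup>2 - c\<^sup>2) * g l)))"
  proof (rule sum_pos2[of _ l0])
    show "l0 \<in> {..<m}" using l0(1) J by (simp add: weight_support_def)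
    have "0 < w l0" using l0(1) w J by (auto simp: weight_support_def less_le)
    moreover have "0 < (ln (tau l0) - ln c) * ((tau l0)\<^sup>2 - c\<^sup>2) * g l0"
      using l0 tau g J by (intro mult_pos_pos sign) (auto simp: weight_support_def)
    ultimately show "0 < w l0 * ((ln (tau l0) - ln c) * (((tau l0)\<^sup>2 - c\<^sup>2) * g l0))"
      by (simp add: mult.assoc)
    fix l assume l: "l \<in> {..<m}"
    show "0 \<le> w l * ((ln (tau l) - ln c) * (((tau l)\<^sup>2 - c\<^sup>2) * g l))"
    proof (cases "w l = 0 \<or> tau l = c")
      case False
      then have "0 < (ln (tau l) - ln c) * ((tau l)\<^sup>2 - c\<^sup>2) * g l"
        using tau g J l by (intro mult_pos_pos sign) (auto simp: weight_support_def)
      then show ?thesis using w l by (simp add: mult.assoc)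
    qed auto
  qed auto
  also have "(\<Sum>l<m. w l * ((ln (tau l) - ln c) * (((tau l)\<^sup>2 - c\<^sup>2) * g l)))
      = (\<Sum>l<m. w l * (ln (tau l) * (((tau l)\<^sup>2 - c\<^sup>2) * g l))) - ln c * (\<Sum>l<m. w l * (((tau l)\<^sup>2 - c\<^sup>2) * g l))"
    unfolding sum_distrib_left sum_subtractf[symmetric] by (intro sum.cong refl) (simp add: algebra_simps)
  finally show ?thesis using zero by simp
qed

section \<open>The update for small exponents\<close>

lemma lawson_update_properties:
  assumes w: "w \<in> weight_simplex m" and J: "J = weight_support m w" and tau: "\<forall>l\<in>J. 0 < tau l"
  shows "0 < (\<Sum>i<m. w i * tau i powr b)"
    and "l < m \<Longrightarrow> 0 \<le> lawson_update m tau b w l"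
    and "l \<in> J \<Longrightarrow> 0 < lawson_update m tau b w l"
proof -
  have nn: "0 \<le> w l" if "l < m" for l using w that by (simp add: weight_simplex_def)
  have "\<exists>l<m. w l \<noteq> 0" 
    by (rule ccontr) (use w in \<open>auto simp: weight_simplex_def\<close>)
  then obtain i where i: "i \<in> J" by (auto simp: J weight_support_def)
  have pos: "0 < w l * tau l powr b" if "l \<in> J" for l
    using that tau nn[of l] by (auto simp: J weight_support_def less_le)
  show S: "0 < (\<Sum>i<m. w i * tau i powr b)"
    using i pos[OF i] nn by (intro sum_pos2[of _ i]) (auto simp: J weight_support_def)
  show "0 \<le> lawson_update m tau b w l" if "l < m"
    unfolding lawson_update_def using S nn that by (intro divide_nonneg_pos) auto
  show "0 < lawson_update m tau b w l" if "l \<in> J"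
    unfolding lawson_update_def using S pos that by (intro divide_pos_pos) auto
qed

lemma lawson_update_tendsto:
  assumes w: "w \<in> weight_simplex m" and J: "J = weight_support m w" and tau: "\<forall>l\<in>J. 0 < tau l"
    and b: "b \<longlonglongrightarrow> 0"
  shows "(\<lambda>k. \<Sum>i<m. w i * tau i powr b k) \<longlonglongrightarrow> 1"
    and "l < m \<Longrightarrow> (\<lambda>k. lawson_update m tau (b k) w l) \<longlonglongrightarrow> w l"
proof -
  have summand: "(\<lambda>k. w l * tau l powr b k) \<longlonglongrightarrow> w l" if "l < m" for l
  \<comment> \<open>Off the support the zero weight removes the term whatever \<open>tau l\<close>
    is. On it positivity matters: the limit factor \<open>tau l powr 0\<close> is 1, whereas
    \<open>0 powr 0\<close> is 0 by convention.\<close>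
  proof (cases "w l = 0")
    case False
    then have "tau l > 0" using tau that by (auto simp: J weight_support_def)
    then have "(\<lambda>k. w l * tau l powr b k) \<longlonglongrightarrow> w l * tau l powr 0" by (intro tendsto_intros b) auto
    then show ?thesis using \<open>tau l > 0\<close> by simp
  qed simp
  then have "(\<lambda>k. \<Sum>i<m. w i * tau i powr b k) \<longlonglongrightarrow> (\<Sum>i<m. w i)" by (intro tendsto_sum) auto
  then show S: "(\<lambda>k. \<Sum>i<m. w i * tau i powr b k) \<longlonglongrightarrow> 1" using w by (simp add: weight_simplex_def)
  show "(\<lambda>k. lawson_update m tau (b k) w l) \<longlonglongrightarrow> w l" if "l < m"
    using tendsto_divide[OF summand[OF that] S] by (simp add: lawson_update_def)
qed

text \<open>The pencil enters only through \<open>unique\<close>, which identifies limits of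
  near-minimizers. Strictness comes from a single support node whose error differs from
  \<open>c\<close>.\<close>

lemma dual_value_strict_increase:
  assumes inj: "inj_on x {..<m}" and w: "w \<in> weight_simplex m" and J: "J = weight_support m w"
    and d: "d < card J" and n: "\<And>i j. i < s \<Longrightarrow> j < t \<Longrightarrow> n i j < card J"
    and min: "dual_minimizer s t n d m x f w p q"
    and unique: "\<And>p' q'. dual_minimizer s t n d m x f w p' q' \<Longrightarrow>
      \<exists>z. q' = smult z q \<and> (\<forall>i<s. \<forall>j<t. p' i j = smult z (p i j))"
    and q_nz: "\<forall>l<m. poly q (x l) \<noteq> 0" and tau: "\<forall>l\<in>J. 0 < tau l"
    and node_error: "\<And>l. l < m \<Longrightarrow> (\<Sum>i<s. \<Sum>j<t. (cmod (f i j (x l) * poly q (x l) - poly (p i j) (x l)))\<^sup>2)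
        = (tau l)\<^sup>2 * (cmod (poly q (x l)))\<^sup>2"
    and l0: "l0 \<in> J" "tau l0 \<noteq> sqrt (dual_value s t n d m x f w)"
  shows "\<exists>beta0>0. \<forall>beta. 0 < beta \<and> beta < beta0 \<longrightarrow>
    dual_value s t n d m x f w < dual_value s t n d m x f (lawson_update m tau beta w)"
proof (rule ccontr)
  let ?lam = "dual_value s t n d m x f w"
  assume "\<not> ?thesis"
  then have "\<forall>e>0. \<exists>b. 0 < b \<and> b < e \<and> dual_value s t n d m x f (lawson_update m tau b w) \<le> ?lam"
    by (meson not_le)
  then have "\<forall>k. \<exists>b. 0 < b \<and> b < 1 / real (Suc k) \<and> dual_value s t n d m x f (lawson_update m tau b w) \<le> ?lam"
    by simp
  then obtain b where b: "\<And>k. 0 < b k" "\<And>k. b k < 1 / real (Suc k)"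
    "\<And>k. dual_value s t n d m x f (lawson_update m tau (b k) w) \<le> ?lam" by metis
  have b_lim: "b \<longlonglongrightarrow> 0"
    by (rule tendsto_sandwich[OF _ _ tendsto_const LIMSEQ_Suc[OF lim_1_over_n]])
       (use b in \<open>auto intro!: always_eventually less_imp_le\<close>)
  define W where "W k = lawson_update m tau (b k) w" for k
  define S where "S k = (\<Sum>i<m. w i * tau i powr b k)" for k
  note lp = lawson_update_properties[OF w J tau]
  have w_nn: "\<forall>l<m. 0 \<le> w l" using w by (simp add: weight_simplex_def)
  have W_nn: "\<forall>l<m. 0 \<le> W k l" for k using lp(2) by (simp add: W_def)
  have W_pos: "0 < W k l" if "l \<in> J" for k l using lp(3)[OF that] by (simp add: W_def)
  have S_pos: "0 < S k" for k using lp(1) by (simp add: S_def)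
  have W_lim: "(\<lambda>k. W k l) \<longlonglongrightarrow> w l" if "l < m" for l
    using lawson_update_tendsto(2)[OF w J tau b_lim that] by (simp add: W_def)
  have S_lim: "S \<longlonglongrightarrow> 1" using lawson_update_tendsto(1)[OF w J tau b_lim] by (simp add: S_def[abs_def])
  have WS: "S k * W k l = w l * tau l powr b k" for k l
    using S_pos[of k] by (simp add: W_def lawson_update_def S_def)
  have J_sub: "J \<subseteq> {..<m}" by (auto simp: J weight_support_def)
  have pq: "\<forall>i<s. \<forall>j<t. p i j \<in> poly_space (n i j)" "q \<in> poly_space d"
    using min by (auto simp: dual_minimizer_def dual_feasible_def)
  \<comment> \<open>The slack is chosen quadratic in \<open>b k\<close>, so that it still tends to
    zero after division by \<open>b k\<close>. Normalizing the given minimizer for the new weights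
    provides the required feasible pair.\<close>
  have "\<exists>P Q. dual_feasible s t n d m x (W k) P Q \<and> dual_objective s t m x f (W k) P Q < ?lam + (b k)\<^sup>2" for k
  proof -
    have "0 < W k l0 * (cmod (poly q (x l0)))\<^sup>2"
      using W_pos[OF l0(1)] q_nz l0(1) J_sub by auto
    then have "0 < (\<Sum>l<m. W k l * (cmod (poly q (x l)))\<^sup>2)"
      using W_nn l0(1) J_sub by (intro sum_pos2[of _ l0]) auto
    from dual_feasible_normalize(1)[OF pq this]
    obtain p' q' where "dual_feasible s t n d m x (W k) p' q'" by blast
    moreover have "dual_value s t n d m x f (W k) < ?lam + (b k)\<^sup>2"
      using b(3)[of k] zero_less_power[OF b(1), of k 2] unfolding W_def by linarith
    ultimately show ?thesis using near_minimizer_exists[OF W_nn] by metis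
  qed
  then obtain P Q where feas: "\<And>k. dual_feasible s t n d m x (W k) (P k) (Q k)"
    and obj: "\<And>k. dual_objective s t m x f (W k) (P k) (Q k) < ?lam + (b k)\<^sup>2" by metis
  have bound: "dual_objective s t m x f (W k) (P k) (Q k) \<le> ?lam + 1" for k
  proof -
    have "b k \<le> 1" using b(2)[of k] by (rule less_imp_le[OF less_le_trans]) (simp add: field_simps)
    then have "(b k)\<^sup>2 \<le> 1" using b(1)[of k] by (simp add: power_le_one)
    then show ?thesis using obj[of k] by linarith
  qed
  have "\<exists>r p' q'. strict_mono (r :: nat \<Rightarrow> nat) \<and>
    (\<forall>i<s. \<forall>j<t. p' i j \<in> poly_space (n i j)) \<and> q' \<in> poly_space d \<and>
    (\<forall>i<s. \<forall>j<t. \<forall>z. (\<lambda>k. poly (P (r k) i j) z) \<longlonglongrightarrow> poly (p' i j) z) \<and>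
    (\<forall>z. (\<lambda>k. poly (Q (r k)) z) \<longlonglongrightarrow> poly q' z)"
  proof (rule near_minimizers_convergent_subseq[where W = W and w = w and J = J])
    show "(\<lambda>k. W k l) \<longlonglongrightarrow> w l" if "l \<in> J" for l using W_lim that J_sub by blast
    show "0 < w l" if "l \<in> J" for l using that w_nn by (auto simp: J weight_support_def less_le)
    show "n i j < card J" if "i < s" "j < t" for i j using n that .
    show "0 < W k l" if "l \<in> J" for k l using W_pos that .
    show "0 \<le> W k l" if "l < m" for k l using W_nn that by blast
  qed (rule inj d J_sub feas bound)+
  then obtain r p' q' where r: "strict_mono (r :: nat \<Rightarrow> nat)"
    and p': "\<forall>i<s. \<forall>j<t. p' i j \<in> poly_space (n i j)" and q': "q' \<in> poly_space d"
    and P_lim: "\<And>z i j. i < s \<Longrightarrow> j < t \<Longrightarrow> (\<lambda>k. poly (P (r k) i j) z) \<longlonglongrightarrow> poly (p' i j) z"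
    and Q_lim: "\<And>z. (\<lambda>k. poly (Q (r k)) z) \<longlonglongrightarrow> poly q' z" by blast
  have sub: "(\<lambda>k. y (r k)) \<longlonglongrightarrow> a" if "y \<longlonglongrightarrow> a" for y :: "nat \<Rightarrow> real" and a
    using LIMSEQ_subseq_LIMSEQ[OF that r] by (simp add: o_def)
  have "(\<lambda>k. \<Sum>l<m. W (r k) l * (cmod (poly (Q (r k)) (x l)))\<^sup>2) \<longlonglongrightarrow> (\<Sum>l<m. w l * (cmod (poly q' (x l)))\<^sup>2)"
    by (intro tendsto_intros sub[OF W_lim] Q_lim) auto
  \<comment> \<open>The constraint holds with value 1 along the whole sequence and passes to the
    limit, so the limit pair is feasible for the old weights.\<close>
  then have norm': "(\<Sum>l<m. w l * (cmod (poly q' (x l)))\<^sup>2) = 1"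
    using feas by (simp add: dual_feasible_def LIMSEQ_const_iff)
  have feas': "dual_feasible s t n d m x w p' q'" using p' q' norm' by (simp add: dual_feasible_def)
  have "(\<lambda>k. dual_objective s t m x f (W (r k)) (P (r k)) (Q (r k))) \<longlonglongrightarrow> dual_objective s t m x f w p' q'"
    unfolding dual_objective_def by (intro tendsto_intros sub[OF W_lim] Q_lim P_lim) auto
  moreover have "(\<lambda>k. ?lam + (b (r k))\<^sup>2) \<longlonglongrightarrow> ?lam + 0\<^sup>2" by (intro tendsto_intros sub b_lim)
  ultimately have "dual_objective s t m x f w p' q' \<le> ?lam + 0\<^sup>2"
    by (rule LIMSEQ_le) (use obj in \<open>auto intro: less_imp_le\<close>)
  then have min': "dual_minimizer s t n d m x f w p' q'"
    using feas' dual_value_le[OF w_nn feas', of f] by (simp add: dual_minimizer_def)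
  from unique[OF this] obtain z where z: "q' = smult z q" "\<forall>i<s. \<forall>j<t. p' i j = smult z (p i j)" by blast
  \<comment> \<open>Both minimizers are normalized, so the scalar has modulus one and the limit pair
    has the same squared quantities at every node as the given pair.\<close>
  have "(\<Sum>l<m. w l * (cmod (poly q' (x l)))\<^sup>2) = (cmod z)\<^sup>2 * (\<Sum>l<m. w l * (cmod (poly q (x l)))\<^sup>2)"
    by (simp add: z(1) norm_mult power_mult_distrib sum_distrib_left mult.left_commute)
  then have z1: "(cmod z)\<^sup>2 = 1" using norm' min by (simp add: dual_minimizer_def dual_feasible_def)

  define G where "G k l = node_gap s t f ?lam (P k) (Q k) (x l)" for k l
  \<comment> \<open>The node \<open>l0\<close> contributes positively to the minimum. This makes
    \<open>c\<close> positive, so that \<open>ln c\<close> can be compared with the logarithms of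
    the errors.\<close>
  have lam_pos: "0 < ?lam"
  proof -
    have "0 < w l0" using l0(1) w_nn by (auto simp: J weight_support_def less_le)
    then have "0 < (\<Sum>l<m. w l * ((tau l)\<^sup>2 * (cmod (poly q (x l)))\<^sup>2))"
    proof (intro sum_pos2[of _ l0])
      have "l0 < m" using l0(1) J_sub by blast
      then have "poly q (x l0) \<noteq> 0" "0 < tau l0" using q_nz tau l0(1) by blast+
      with \<open>0 < w l0\<close> show "0 < w l0 * ((tau l0)\<^sup>2 * (cmod (poly q (x l0)))\<^sup>2)" by simp
    qed (use l0(1) J_sub w_nn in auto)
    also have "\<dots> = dual_objective s t m x f w p q"
      unfolding dual_objective_def by (intro sum.cong refl) (simp add: node_error)
    also have "\<dots> = ?lam" using min by (simp add: dual_minimizer_def)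
    finally show ?thesis .
  qed
  define c where "c = sqrt ?lam"
  have c: "0 < c" "c\<^sup>2 = ?lam" using lam_pos by (auto simp: c_def)
  let ?g = "\<lambda>l. (cmod (poly q (x l)))\<^sup>2"
  have gap': "node_gap s t f ?lam p' q' (x l) = ((tau l)\<^sup>2 - c\<^sup>2) * ?g l" if "l < m" for l
  proof -
    have "(cmod (f i j (x l) * poly q' (x l) - poly (p' i j) (x l)))\<^sup>2
        = (cmod (f i j (x l) * poly q (x l) - poly (p i j) (x l)))\<^sup>2" if "i < s" "j < t" for i j
    proof -
      have "f i j (x l) * poly q' (x l) - poly (p' i j) (x l) = z * (f i j (x l) * poly q (x l) - poly (p i j) (x l))"
        using z that by (simp add: algebra_simps)
      then show ?thesis using z1 by (simp add: norm_mult power_mult_distrib)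
    qed
    then have "(\<Sum>i<s. \<Sum>j<t. (cmod (f i j (x l) * poly q' (x l) - poly (p' i j) (x l)))\<^sup>2) = (tau l)\<^sup>2 * ?g l"
      using node_error[OF that] by simp
    moreover have "(cmod (poly q' (x l)))\<^sup>2 = ?g l" using z(1) z1 by (simp add: norm_mult power_mult_distrib)
    ultimately show ?thesis by (simp add: node_gap_def c(2) left_diff_distrib)
  qed
  have G_lim: "(\<lambda>k. G (r k) l) \<longlonglongrightarrow> ((tau l)\<^sup>2 - c\<^sup>2) * ?g l" if "l < m" for l
    unfolding G_def gap'[OF that, symmetric] node_gap_def
    by (intro tendsto_intros P_lim Q_lim) auto
  \<comment> \<open>Near-optimality bounds the gap for the new weights above by the slack, and
    optimality of the dual value makes the gap of the same pair for the old weights nonnegative.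
    Multiplying the former by \<open>S k\<close> clears the denominator of the update; the
    difference of the two gaps then contains the factor \<open>tau l powr b k - 1\<close>, and
    division by \<open>b k\<close> gives the claim.\<close>
  have quotient: "(\<Sum>l<m. w l * ((tau l powr b k - 1) / b k * G k l)) \<le> S k * b k" for k
  proof -
    have "(\<Sum>l<m. W k l * G k l) \<le> (b k)\<^sup>2"
      using obj[of k] feas[of k] unfolding G_def weighted_gap_eq_sum_node_gap[symmetric]
      by (simp add: weighted_gap_def dual_feasible_def)
    then have "S k * (\<Sum>l<m. W k l * G k l) \<le> S k * (b k)\<^sup>2"
      using S_pos by (intro mult_left_mono) (auto intro: less_imp_le)
    moreover have "0 \<le> (\<Sum>l<m. w l * G k l)"
      unfolding G_def weighted_gap_eq_sum_node_gap[symmetric]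
      using feas[of k] by (intro weighted_gap_nonneg w_nn) (auto simp: dual_feasible_def)
    ultimately have "S k * (\<Sum>l<m. W k l * G k l) - (\<Sum>l<m. w l * G k l) \<le> S k * (b k)\<^sup>2" by linarith
    also have "S k * (\<Sum>l<m. W k l * G k l) - (\<Sum>l<m. w l * G k l)
        = b k * (\<Sum>l<m. w l * ((tau l powr b k - 1) / b k * G k l))"
      unfolding sum_distrib_left sum_subtractf[symmetric] mult.assoc[symmetric] WS
      using b(1)[of k] by (intro sum.cong refl) (simp add: field_simps)
    also have "S k * (b k)\<^sup>2 = b k * (S k * b k)" by (simp add: power2_eq_square)
    finally show ?thesis using b(1)[of k] by simp
  qed
  have summand_lim: "(\<lambda>k. w l * ((tau l powr b (r k) - 1) / b (r k) * G (r k) l))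
      \<longlonglongrightarrow> w l * (ln (tau l) * (((tau l)\<^sup>2 - c\<^sup>2) * ?g l))" if "l < m" for l
  \<comment> \<open>Off the support \<open>tau l\<close> may vanish and the difference quotient may
    diverge, but the zero weight removes the term.\<close>
  proof (cases "w l = 0")
    case False
    then have "0 < tau l" using tau that by (auto simp: J weight_support_def)
    then have "(\<lambda>k. (tau l powr b (r k) - 1) / b (r k)) \<longlonglongrightarrow> ln (tau l)"
      using b(1) sub[OF b_lim] by (intro powr_difference_quotient_tendsto_ln) (auto simp: less_imp_neq[symmetric])
    then show ?thesis by (intro tendsto_intros G_lim that)
  qed simp
  have "(\<lambda>k. \<Sum>l<m. w l * ((tau l powr b (r k) - 1) / b (r k) * G (r k) l))
      \<longlonglongrightarrow> (\<Sum>l<m. w l * (ln (tau l) * (((tau l)\<^sup>2 - c\<^sup>2) * ?g l)))"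
    by (intro tendsto_sum summand_lim) auto
  moreover have "(\<lambda>k. S (r k) * b (r k)) \<longlonglongrightarrow> 1 * 0" by (intro tendsto_intros sub S_lim b_lim)
  ultimately have "(\<Sum>l<m. w l * (ln (tau l) * (((tau l)\<^sup>2 - c\<^sup>2) * ?g l))) \<le> 1 * 0"
    by (rule LIMSEQ_le) (use quotient in auto)
  moreover have "(\<Sum>l<m. w l * (((tau l)\<^sup>2 - c\<^sup>2) * ?g l)) = 0"
  proof -
    have "(\<Sum>l<m. w l * (((tau l)\<^sup>2 - c\<^sup>2) * ?g l)) = weighted_gap s t m x f w ?lam p' q'"
      unfolding weighted_gap_eq_sum_node_gap by (intro sum.cong refl) (simp add: gap')
    also have "\<dots> = 0" using min' by (simp add: weighted_gap_def dual_minimizer_def dual_feasible_def)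
    finally show ?thesis .
  qed
  ultimately show False
    using log_weighted_gap_pos[OF w_nn J tau c(1) _ l0(1), of ?g] l0(2) q_nz by (simp add: c_def)
qed

section \<open>Fixed points of the update and the theorem\<close>

lemma dual_value_cong:
  assumes "\<forall>l<m. w l = w' l"
  shows "dual_value s t n d m x f w = dual_value s t n d m x f w'"
  using assms unfolding dual_value_def dual_objective_def dual_feasible_def by simp

text \<open>A common error \<open>c\<close> on the support factors out of numerator and denominator
  alike and cancels, since a power of a positive number is nonzero.\<close>

lemma lawson_update_const_error:
  assumes w: "w \<in> weight_simplex m" and tau: "\<forall>l\<in>weight_support m w. tau l = c" and c: "0 < c"
    and l: "l < m"
  shows "lawson_update m tau b w l = w l"
proof -
  have eq: "w i * tau i powr b = w i * c powr b" if "i < m" for i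
    using tau that by (cases "w i = 0") (auto simp: weight_support_def)
  have "(\<Sum>i<m. w i * tau i powr b) = c powr b"
    using w by (simp add: eq sum_distrib_right[symmetric] weight_simplex_def)
  then show ?thesis using c by (simp add: lawson_update_def eq[OF l])
qed


theorem theorem7p2:
  fixes s t d m k :: nat
    and n :: "nat \<Rightarrow> nat \<Rightarrow> nat"
    and x :: "nat \<Rightarrow> complex"
    and f :: "nat \<Rightarrow> nat \<Rightarrow> complex \<Rightarrow> complex"
    and psi :: "nat \<Rightarrow> nat \<Rightarrow> nat \<Rightarrow> complex poly"
    and phi :: "nat \<Rightarrow> complex poly"
    and b :: "nat \<Rightarrow> real"
    and w :: "nat \<Rightarrow> nat \<Rightarrow> real"
    and p :: "nat \<Rightarrow> nat \<Rightarrow> nat \<Rightarrow> complex poly"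
    and q :: "nat \<Rightarrow> complex poly"
    and R :: "complex poly fract mat"
    and tau :: "nat \<Rightarrow> real"
    and J :: "nat set"
    and c :: real
  assumes "s \<ge> 1" and "t \<ge> 1"
    and "inj_on x {..<m}"
    and "(MAX (i,j)\<in>{..<s} \<times> {..<t}. n i j + d + 2) \<le> m"
    and "\<forall>i<s. \<forall>j<t. poly_basis (n i j) (psi i j)"
    and "poly_basis d phi"
    and run: "md_Lawson_run s t n d m x f b w p q"
    and A1: "\<forall>k'. \<forall>l<m. poly (q k') (x l) \<noteq> 0"
    and A2: "\<forall>k'. max (d + 1) (MAX (i,j)\<in>{..<s} \<times> {..<t}. n i j + 1)
                     \<le> card (weight_support m (w k'))"
    and "w k \<in> weight_simplex m"
    and simple: "simple_pencil_eigenvalue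
           (pencil_A s t n d m x f psi phi (w k)) (pencil_B s t n d m x phi (w k))
           (complex_of_real (dual_value s t n d m x f (w k)))"
    and R_eq: "R = ratmat s t (p k) (q k)"
    and tau_eq: "\<And>l. tau l = residual s t f R (x l)"
    and J_eq: "J = weight_support m (w k)"
    and c_eq: "c = sqrt (dual_value s t n d m x f (w k))"
    and tau_pos: "\<forall>l\<in>J. tau l > 0"
  shows
    "(\<exists>beta0>0. \<forall>beta. 0 < beta \<and> beta < beta0 \<longrightarrow>
        dual_value s t n d m x f (lawson_update m tau beta (w k))
          \<ge> dual_value s t n d m x f (w k))
     \<and>
     ((\<exists>beta0>0. \<forall>beta. 0 < beta \<and> beta < beta0 \<longrightarrow>
        dual_value s t n d m x f (lawson_update m tau beta (w k))
          = dual_value s t n d m x f (w k) \<longrightarrow>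
        (\<forall>l<m. w k l * tau l * (tau l - c) = 0))
      \<and> max_sq_error s t m x f R < \<infinity>
      \<and> c \<le> sqrt (real_of_ereal (max_sq_error s t m x f R))
      \<and> sqrt (real_of_ereal (max_sq_error s t m x f R)) = (MAX l\<in>{..<m}. tau l))
     \<and>
     (\<exists>beta0>0. \<forall>beta. 0 < beta \<and> beta < beta0 \<longrightarrow>
        dual_value s t n d m x f (lawson_update m tau beta (w k))
          = dual_value s t n d m x f (w k) \<longrightarrow>
        (\<forall>l<m. l \<notin> J \<longrightarrow> tau l \<le> c) \<longrightarrow>
        is_minimax_approximant s t n d m x f R)"
proof -
  let ?lam = "dual_value s t n d m x f (w k)" and ?p = "p k" and ?q = "q k"
  let ?M = "MAX l\<in>{..<m}. tau l"
  from run have min: "dual_minimizer s t n d m x f (w k) ?p ?q" by (simp add: md_Lawson_run_def)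
  then have pq: "\<forall>i<s. \<forall>j<t. ?p i j \<in> poly_space (n i j)" "?q \<in> poly_space d"
    by (auto simp: dual_minimizer_def dual_feasible_def)
  have w_nn: "\<forall>l<m. 0 \<le> w k l" using \<open>w k \<in> weight_simplex m\<close> by (simp add: weight_simplex_def)
  have q_nz: "\<forall>l<m. poly ?q (x l) \<noteq> 0" using A1 by blast
  have card: "max (d + 1) (MAX (i,j)\<in>{..<s} \<times> {..<t}. n i j + 1) \<le> card J" using A2 J_eq by blast
  then have d: "d < card J" by simp
  \<comment> \<open>Condition (A2) counts coefficients, one more than the degree, hence the strict
    inequality.\<close>
  have n: "n i j < card J" if "i < s" "j < t" for i j
  proof -
    have "n i j + 1 \<le> (MAX (i,j)\<in>{..<s} \<times> {..<t}. n i j + 1)"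
      using that by (intro Max_ge) auto
    with card show ?thesis by simp
  qed
  have "J \<noteq> {}" using d by auto
  then obtain l1 where l1: "l1 \<in> J" "l1 < m" by (auto simp: J_eq weight_support_def)
  have "?q \<noteq> 0" using q_nz l1(2) by auto
  have R: "R \<in> ratmats s t n d" unfolding R_eq ratmats_def using pq \<open>?q \<noteq> 0\<close> by blast
  have no_pole: "\<forall>i<s. \<forall>j<t. \<not> has_pole (Fract (?p i j) ?q) (x l)" if "l < m" for l
    using q_nz that not_has_pole_Fract by blast
  have node_error: "(\<Sum>i<s. \<Sum>j<t. (cmod (f i j (x l) * poly ?q (x l) - poly (?p i j) (x l)))\<^sup>2)
      = (tau l)\<^sup>2 * (cmod (poly ?q (x l)))\<^sup>2" if "l < m" for l
    unfolding tau_eq R_eq by (rule node_error_eq_residual[OF \<open>?q \<noteq> 0\<close> no_pole[OF that]])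
  have tau_nn: "0 \<le> tau l" for l by (simp add: tau_eq residual_nonneg)
  have sq_err: "sq_error s t f R (x l) = ereal ((tau l)\<^sup>2)" if "l < m" for l
    using no_pole[OF that] unfolding sq_error_def tau_eq by (auto simp: R_eq ratmat_def)
  have tau_le: "tau l \<le> ?M" if "l < m" for l using that by (intro Max_ge) auto
  have M_nn: "0 \<le> ?M" using tau_nn tau_le[OF l1(2)] order.trans by blast
  \<comment> \<open>No node is a pole, so all errors are finite, and squaring commutes with the
    maximum because the residuals are nonnegative.\<close>
  have max_err: "max_sq_error s t m x f R = ereal (?M\<^sup>2)"
    unfolding max_sq_error_def
  proof (rule Max_eqI)
    have "?M \<in> tau ` {..<m}" using l1(2) by (intro Max_in) auto
    then obtain l where "l < m" "?M = tau l" by auto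
    then show "ereal (?M\<^sup>2) \<in> (\<lambda>l. sq_error s t f R (x l)) ` {..<m}" using sq_err by force
    show "y \<le> ereal (?M\<^sup>2)" if "y \<in> (\<lambda>l. sq_error s t f R (x l)) ` {..<m}" for y
      using that sq_err tau_le tau_nn by (auto intro!: power_mono)
  qed simp
  have weak_duality: "ereal ?lam \<le> max_sq_error s t m x f R'" if "R' \<in> ratmats s t n d" for R'
    using that d unfolding J_eq by (intro dual_value_le_max_sq_error w_nn \<open>inj_on x {..<m}\<close>)
  have lam_nn: "0 \<le> ?lam"
    using dual_objective_nonneg[OF w_nn] min by (metis dual_minimizer_def)
  \<comment> \<open>Weak duality applied to \<open>R\<close> itself.\<close>
  have "?lam \<le> ?M\<^sup>2" using weak_duality[OF R] max_err by simp
  then have c_le: "c \<le> ?M" using M_nn unfolding c_eq by (intro real_le_lsqrt)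

  \<comment> \<open>Either the errors are equal on the support or the dual value grows strictly for
    all small exponents. All three claims are read off from these two cases.\<close>
  have dichotomy: "(\<forall>l\<in>J. tau l = c) \<or> (\<exists>beta0>0. \<forall>beta. 0 < beta \<and> beta < beta0 \<longrightarrow>
      ?lam < dual_value s t n d m x f (lawson_update m tau beta (w k)))"
  proof (cases "\<forall>l\<in>J. tau l = c")
    case False
    then obtain l0 where "l0 \<in> J" "tau l0 \<noteq> sqrt ?lam" unfolding c_eq by blast
    then have "\<exists>beta0>0. \<forall>beta. 0 < beta \<and> beta < beta0 \<longrightarrow>
      ?lam < dual_value s t n d m x f (lawson_update m tau beta (w k))"
      using dual_minimizer_unique[OF assms(5) \<open>poly_basis d phi\<close> w_nn simple min]
      by (intro dual_value_strict_increase[OF \<open>inj_on x {..<m}\<close> \<open>w k \<in> weight_simplex m\<close> J_eq d n min _ q_nz tau_pos node_error])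
    then show ?thesis by blast
  qed blast
  \<comment> \<open>Equal errors on the support make the weights a fixed point for every exponent;
    \<open>c\<close> is positive because it is the error at the support node
    \<open>l1\<close>.\<close>
  have const: "dual_value s t n d m x f (lawson_update m tau beta (w k)) = ?lam" if "\<forall>l\<in>J. tau l = c" for beta
  proof -
    have "0 < c" using that l1(1) tau_pos by force
    then have "\<forall>l<m. lawson_update m tau beta (w k) l = w k l"
      using lawson_update_const_error[OF \<open>w k \<in> weight_simplex m\<close> that[unfolded J_eq]] by blast
    then show ?thesis by (rule dual_value_cong)
  qed
  have increase: "\<exists>beta0>0. \<forall>beta. 0 < beta \<and> beta < beta0 \<longrightarrow>
      ?lam \<le> dual_value s t n d m x f (lawson_update m tau beta (w k)) \<and>
      (dual_value s t n d m x f (lawson_update m tau beta (w k)) = ?lam \<longrightarrow> (\<forall>l\<in>J. tau l = c))"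
    using dichotomy
  proof
    assume "\<forall>l\<in>J. tau l = c"
    \<comment> \<open>Any positive bound on the exponent would do here; 1 is an arbitrary
      choice.\<close>
    then show ?thesis using const by (intro exI[of _ 1]) simp
  next
    assume "\<exists>beta0>0. \<forall>beta. 0 < beta \<and> beta < beta0 \<longrightarrow>
      ?lam < dual_value s t n d m x f (lawson_update m tau beta (w k))"
    then show ?thesis by (metis less_imp_le less_irrefl)
  qed
  \<comment> \<open>This one threshold serves all three claims.\<close>
  then obtain beta0 where "0 < beta0" and beta0: "\<And>beta. 0 < beta \<Longrightarrow> beta < beta0 \<Longrightarrow>
      ?lam \<le> dual_value s t n d m x f (lawson_update m tau beta (w k))"
    "\<And>beta. 0 < beta \<Longrightarrow> beta < beta0 \<Longrightarrow>
      dual_value s t n d m x f (lawson_update m tau beta (w k)) = ?lam \<Longrightarrow> \<forall>l\<in>J. tau l = c" by blast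
  have slackness: "\<forall>l<m. w k l * tau l * (tau l - c) = 0" if "\<forall>l\<in>J. tau l = c"
    using that by (auto simp: J_eq weight_support_def)
  \<comment> \<open>The extra bound off the support makes the maximal error equal to
    \<open>c\<close>, so the squared error of \<open>R\<close> attains the dual value, which bounds
    the error of every competitor from below.\<close>
  have minimax: "is_minimax_approximant s t n d m x f R"
    if "\<forall>l\<in>J. tau l = c" "\<forall>l<m. l \<notin> J \<longrightarrow> tau l \<le> c"
  proof -
    have "?M \<le> c" using that l1(2) by (subst Max_le_iff) force+
    with c_le have "?M = c" by (rule antisym[rotated])
    then have "?M\<^sup>2 = ?lam" using lam_nn by (simp add: c_eq)
    then have "max_sq_error s t m x f R \<le> (INF R'\<in>ratmats s t n d. max_sq_error s t m x f R')"
      unfolding max_err by (intro INF_greatest) (simp add: weak_duality)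
    then show ?thesis unfolding is_minimax_approximant_def
      using R by (auto intro: antisym INF_lower)
  qed
  show ?thesis
    using \<open>0 < beta0\<close> beta0 slackness minimax c_le M_nn max_err by (intro conjI exI[of _ beta0]) auto
qed

end
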